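(* Let $t\in\mathbb{R}$, $s>0$ be such that $W_f(t,s)\neq0$ and $\mathbb{E}[|W_\Phi(t,s)|^2]>0$, and let $$q(t,s)=\frac{|W_f(t,s)|^2}{\mathbb{E}[|W_\Phi(t,s)|^2]}.$$ Then for any $\varepsilon>0$, $$\mathbb{P}\left(\left|\frac{|W_Y(t,s)|}{|W_f(t,s)|}-1\right|>\varepsilon\right)\le\exp\left(-\frac{\varepsilon^2}{16}q(t,s)\right)+\exp\left(-\frac{\varepsilon}{2}q(t,s)\right).$$
   Context: The function $\psi:\mathbb{R}\to\mathbb{C}$ belongs to $L^1(\mathbb{R})\cap L^2(\mathbb{R})$, with Fourier transform $\widehat\psi(\omega)=\int_{\mathbb{R}}e^{-it\omega}\psi(t)\,dt$. It is an analytic mother wavelet: $\widehat\psi(\omega)=0$ for $\omega\le0$; moreover $|\widehat\psi|$ is unimodal with a unique maximum point in $(0,\infty)$. The function $f:\mathbb{R}\to\mathbb{R}$ is bounded and deterministic. The noise $\Phi=\{\Phi(t)\}_{t\in\mathbb{R}}$ is a real-valued stationary Gaussian process with constant mean and covariance function $C_\Phi(t_1-t_2)=\mathrm{Cov}(\Phi(t_1),\Phi(t_2))$, which has the spectral representation $C_\Phi(t)=\int_{\mathbb{R}}e^{i\lambda t}F(d\lambda)$ with $F$ a nonnegative measure, $F(\mathbb{R})=C_\Phi(0)$. The observed signal is $Y=f+\Phi$. For $g\in\{f,\Phi,Y\}$, the analytic wavelet transform is $W_g(t,s)=\int_{\mathbb{R}}g(\tau)\frac{1}{\sqrt s}\overline{\psi\left(\frac{\tau-t}{s}\right)}d\tau$,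 $t\in\mathbb{R}$, $s>0$. *)

theory Defs
  imports "HOL-Probability.Probability"
begin

text \<open>The Lebesgue integral over the real line is taken with respect to \<open>lebesgue\<close> (the completion
  of \<open>lborel\<close>), so that \<open>\<psi>\<close> and \<open>f\<close> need not be Borel.\<close>

definition fourier_transform :: "(real \<Rightarrow> complex) \<Rightarrow> real \<Rightarrow> complex" where
  "fourier_transform \<psi> \<omega> = (CLINT t|lebesgue. iexp (- (t * \<omega>)) * \<psi> t)"

text \<open>Unimodality is taken in the weak (non-strict) monotonicity sense.\<close>

definition unimodal_unique_max_at :: "(real \<Rightarrow> real) \<Rightarrow> real \<Rightarrow> bool" where
  "unimodal_unique_max_at h m \<longleftrightarrow>
     mono_on {..m} h \<and> antimono_on {m..} h \<and> (\<forall>x. x \<noteq> m \<longrightarrow> h x < h m)"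

definition analytic_mother_wavelet :: "(real \<Rightarrow> complex) \<Rightarrow> bool" where
  "analytic_mother_wavelet \<psi> \<longleftrightarrow>
     integrable lebesgue \<psi> \<and>
     integrable lebesgue (\<lambda>t. (cmod (\<psi> t))\<^sup>2) \<and>
     (\<forall>\<omega>\<le>0. fourier_transform \<psi> \<omega> = 0) \<and>
     (\<exists>m>0. unimodal_unique_max_at (\<lambda>\<omega>. cmod (fourier_transform \<psi> \<omega>)) m)"

definition wavelet_transform ::
    "(real \<Rightarrow> complex) \<Rightarrow> (real \<Rightarrow> real) \<Rightarrow> real \<Rightarrow> real \<Rightarrow> complex" where
  "wavelet_transform \<psi> g t s =
     (CLINT \<tau>|lebesgue. of_real (g \<tau>) * of_real (1 / sqrt s) * cnj (\<psi> ((\<tau> - t) / s)))"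

text \<open>Degenerate (constant) variables count as Gaussian, as usual for Gaussian processes.\<close>

definition gaussian_variable :: "'w measure \<Rightarrow> ('w \<Rightarrow> real) \<Rightarrow> bool" where
  "gaussian_variable M X \<longleftrightarrow>
     X \<in> borel_measurable M \<and>
     (\<exists>\<mu>. distr M borel X = return borel \<mu> \<or>
          (\<exists>\<sigma>>0. distributed M lborel X (\<lambda>x. ennreal (normal_density \<mu> \<sigma> x))))"

text \<open>A process is Gaussian if its finite-dimensional distributions are multivariate normal, i.e. if
  every finite linear combination of its values is a (possibly degenerate) Gaussian variable.\<close>

definition gaussian_process :: "'w measure \<Rightarrow> (real \<Rightarrow> 'w \<Rightarrow> real) \<Rightarrow> bool" where
  "gaussian_process M \<Phi> \<longleftrightarrow>
     (\<forall>T a. finite T \<longrightarrow> gaussian_variable M (\<lambda>w. \<Sum>t\<in>T. a t * \<Phi> t w))"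

definition covariance :: "'w measure \<Rightarrow> ('w \<Rightarrow> real) \<Rightarrow> ('w \<Rightarrow> real) \<Rightarrow> real" where
  "covariance M X Y =
     (LINT w|M. (X w - (LINT v|M. X v)) * (Y w - (LINT v|M. Y v)))"

text \<open>For a Gaussian process this is equivalent to strict stationarity.\<close>

definition stationary_with_covariance ::
    "'w measure \<Rightarrow> (real \<Rightarrow> 'w \<Rightarrow> real) \<Rightarrow> (real \<Rightarrow> real) \<Rightarrow> bool" where
  "stationary_with_covariance M \<Phi> C \<longleftrightarrow>
     (\<exists>\<mu>. \<forall>t. (LINT w|M. \<Phi> t w) = \<mu>) \<and>
     (\<forall>t\<^sub>1 t\<^sub>2. covariance M (\<Phi> t\<^sub>1) (\<Phi> t\<^sub>2) = C (t\<^sub>1 - t\<^sub>2))"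

definition spectral_measure_of :: "real measure \<Rightarrow> (real \<Rightarrow> real) \<Rightarrow> bool" where
  "spectral_measure_of F C \<longleftrightarrow>
     sets F = sets borel \<and>
     emeasure F UNIV = ennreal (C 0) \<and>
     (\<forall>t. complex_of_real (C t) = (CLINT \<xi>|F. iexp (\<xi> * t)))"

text \<open>Joint measurability in time and outcome makes the pathwise integral
  \<open>wavelet_transform \<psi> (\<lambda>\<tau>. \<Phi> \<tau> w) t s\<close> a random variable.\<close>

definition jointly_measurable :: "'w measure \<Rightarrow> (real \<Rightarrow> 'w \<Rightarrow> real) \<Rightarrow> bool" where
  "jointly_measurable M \<Phi> \<longleftrightarrow> (\<lambda>(\<tau>, w). \<Phi> \<tau> w) \<in> borel_measurable (lebesgue \<Otimes>\<^sub>M M)"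

definition signal_noise_ratio ::
    "'w measure \<Rightarrow> (real \<Rightarrow> complex) \<Rightarrow> (real \<Rightarrow> real) \<Rightarrow> (real \<Rightarrow> 'w \<Rightarrow> real) \<Rightarrow> real \<Rightarrow> real \<Rightarrow> real"
  where
  "signal_noise_ratio M \<psi> f \<Phi> t s =
     (cmod (wavelet_transform \<psi> f t s))\<^sup>2 /
     (LINT w|M. (cmod (wavelet_transform \<psi> (\<lambda>\<tau>. \<Phi> \<tau> w) t s))\<^sup>2)"

end

theory Submission
  imports Defs
begin

text \<open>
  The wavelet transform is linear, so almost surely \<open>W_Y = W_f + W_\<Phi>\<close>, and by the triangle inequality
  a relative deviation larger than \<open>\<epsilon>\<close> forces \<open>|W_\<Phi>| > \<epsilon> |W_f|\<close>, that is
  \<open>|W_\<Phi>|\<^sup>2 > x E|W_\<Phi>|\<^sup>2\<close> with \<open>x = \<epsilon>\<^sup>2 q\<close>. The proof bounds the probability of this event by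
  \<open>exp (- x / 16)\<close>, the first of the two exponentials. Two facts about \<open>W_\<Phi>\<close> are needed.

  First, the real and imaginary parts of \<open>W_\<Phi>\<close> are jointly Gaussian with mean zero
  (\<open>centered_gaussian_integral\<close>). The mean vanishes because \<open>\<integral>\<psi> = 0\<close>, as the Fourier transform of
  \<open>\<psi>\<close> is zero at the origin. A real linear combination of the two parts is an integral
  \<open>\<integral> k(\<tau>) \<Phi>(\<tau>) d\<tau>\<close>, and it is Gaussian because it is an \<open>L\<^sup>2\<close> limit of finite linear
  combinations of values of the process. The approximants come from an empirical-mean argument
  (\<open>L2_approx_by_sampling\<close>): the integral is the mean of \<open>\<parallel>k\<parallel> sgn(k(\<tau>)) \<Phi>(\<tau>)\<close> when \<open>\<tau>\<close> is drawn with
  density \<open>|k| / \<parallel>k\<parallel>\<close>, and an average of \<open>n\<close> well chosen samples has squared error \<open>O(1/n)\<close>. Joint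
  measurability of the process justifies the exchanges of integrals.

  Secondly, every centred Gaussian vector \<open>Z\<close> in the plane satisfies
  \<open>P(|Z|\<^sup>2 > x E|Z|\<^sup>2) \<le> exp (- x / 16)\<close> (\<open>centered_gaussian_pair_tail\<close>). For large \<open>x\<close> this follows
  from the Gaussian tails of the coordinates and for moderate \<open>x\<close> from Markov's inequality. For small
  \<open>x\<close> it amounts to a lower bound for the probability that \<open>Z\<close> falls in a small disc
  (\<open>centered_gaussian_pair_small_ball\<close>), which is obtained by a duality: \<open>E exp (- c\<^sup>2 |Z|\<^sup>2 / 2)\<close> equals the
  mean of \<open>exp (- c\<^sup>2 V(N) / 2)\<close>, where \<open>N\<close> is a standard normal vector and \<open>V(u)\<close> is the variance of
  the inner product of \<open>u\<close> with \<open>Z\<close>.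
\<close>

section \<open>Products of square-integrable functions\<close>

lemma integrable_mult_of_square_integrable:
  fixes f g :: "'a \<Rightarrow> real"
  assumes [measurable]: "f \<in> borel_measurable M" "g \<in> borel_measurable M"
    and f2: "integrable M (\<lambda>x. (f x)\<^sup>2)" and g2: "integrable M (\<lambda>x. (g x)\<^sup>2)"
  shows "integrable M (\<lambda>x. f x * g x)"
proof (rule Bochner_Integration.integrable_bound)
  show "integrable M (\<lambda>x. (f x)\<^sup>2 + (g x)\<^sup>2)" using f2 g2 by simp
  have "\<bar>a * b\<bar> \<le> a\<^sup>2 + b\<^sup>2" for a b :: real
  proof -
    have "2 * (\<bar>a\<bar> * \<bar>b\<bar>) \<le> a\<^sup>2 + b\<^sup>2"
      using sum_squares_bound[of "\<bar>a\<bar>" "\<bar>b\<bar>"] by (simp add: mult.assoc)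
    moreover have "0 \<le> \<bar>a\<bar> * \<bar>b\<bar>" by simp
    ultimately show ?thesis unfolding abs_mult by linarith
  qed
  then show "AE x in M. norm (f x * g x) \<le> norm ((f x)\<^sup>2 + (g x)\<^sup>2)" by simp
qed simp

lemma Cauchy_Schwarz_integral:
  fixes f g :: "'a \<Rightarrow> real"
  assumes [measurable]: "f \<in> borel_measurable M" "g \<in> borel_measurable M"
    and f2: "integrable M (\<lambda>x. (f x)\<^sup>2)" and g2: "integrable M (\<lambda>x. (g x)\<^sup>2)"
  shows "(LINT x|M. \<bar>f x * g x\<bar>) \<le> sqrt (LINT x|M. (f x)\<^sup>2) * sqrt (LINT x|M. (g x)\<^sup>2)"
proof -
  have fg: "integrable M (\<lambda>x. \<bar>f x * g x\<bar>)"
    using integrable_mult_of_square_integrable[OF assms] by simp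
  have "(\<integral>\<^sup>+x. ennreal \<bar>f x\<bar> * ennreal \<bar>g x\<bar> \<partial>M)\<^sup>2
      \<le> (\<integral>\<^sup>+x. (ennreal \<bar>f x\<bar>)\<^sup>2 \<partial>M) * (\<integral>\<^sup>+x. (ennreal \<bar>g x\<bar>)\<^sup>2 \<partial>M)"
    by (rule Cauchy_Schwarz_nn_integral) auto
  also have "(\<integral>\<^sup>+x. (ennreal \<bar>f x\<bar>)\<^sup>2 \<partial>M) = ennreal (LINT x|M. (f x)\<^sup>2)"
    using f2 by (subst nn_integral_eq_integral[symmetric]) (auto simp: ennreal_power)
  also have "(\<integral>\<^sup>+x. (ennreal \<bar>g x\<bar>)\<^sup>2 \<partial>M) = ennreal (LINT x|M. (g x)\<^sup>2)"
    using g2 by (subst nn_integral_eq_integral[symmetric]) (auto simp: ennreal_power)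
  also have "(\<integral>\<^sup>+x. ennreal \<bar>f x\<bar> * ennreal \<bar>g x\<bar> \<partial>M) = ennreal (LINT x|M. \<bar>f x * g x\<bar>)"
    using fg by (subst nn_integral_eq_integral[symmetric]) (auto simp: ennreal_mult abs_mult)
  finally have "(LINT x|M. \<bar>f x * g x\<bar>)\<^sup>2 \<le> (LINT x|M. (f x)\<^sup>2) * (LINT x|M. (g x)\<^sup>2)"
    by (simp add: ennreal_power ennreal_mult[symmetric])
  then show ?thesis
    by (simp add: real_le_rsqrt real_sqrt_mult[symmetric])
qed

section \<open>Centred Gaussian variables\<close>

text \<open>
  A (possibly degenerate) normal law of mean zero, described by its characteristic function: this form
  covers the degenerate case and passes to \<open>L\<^sup>2\<close> limits.
\<close>

definition centered_gaussian :: "'w measure \<Rightarrow> ('w \<Rightarrow> real) \<Rightarrow> bool" where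
  "centered_gaussian M X \<longleftrightarrow>
     X \<in> borel_measurable M \<and> integrable M (\<lambda>w. (X w)\<^sup>2) \<and>
     (\<forall>r. (CLINT w|M. iexp (r * X w)) = of_real (exp (- (r\<^sup>2 * (LINT w|M. (X w)\<^sup>2) / 2))))"

context prob_space
begin

lemma integrable_of_square_integrable:
  fixes X :: "'a \<Rightarrow> real"
  assumes "X \<in> borel_measurable M" "integrable M (\<lambda>w. (X w)\<^sup>2)"
  shows "integrable M X"
  using integrable_mult_of_square_integrable[of X M "\<lambda>_. 1"] assms by simp

lemma centered_gaussian_cong_AE:
  assumes X: "centered_gaussian M X" and [measurable]: "Y \<in> borel_measurable M"
    and eq: "AE w in M. X w = Y w"
  shows "centered_gaussian M Y"
proof -
  have [measurable]: "X \<in> borel_measurable M" using X by (simp add: centered_gaussian_def)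
  have sq: "(LINT w|M. (X w)\<^sup>2) = (LINT w|M. (Y w)\<^sup>2)"
    using eq by (intro integral_cong_AE) auto
  have "integrable M (\<lambda>w. (X w)\<^sup>2) \<longleftrightarrow> integrable M (\<lambda>w. (Y w)\<^sup>2)"
    using eq by (intro integrable_cong_AE) auto
  moreover have "(CLINT w|M. iexp (r * X w)) = (CLINT w|M. iexp (r * Y w))" for r
    using eq by (intro integral_cong_AE) auto
  ultimately show ?thesis using X sq by (simp add: centered_gaussian_def)
qed

lemma gaussian_variable_centered:
  assumes X: "gaussian_variable M X"
  shows "integrable M (\<lambda>w. (X w)\<^sup>2)" (is ?int)
    and "centered_gaussian M (\<lambda>w. X w - expectation X)" (is ?cent)
proof -
  have [measurable]: "X \<in> borel_measurable M" using X by (simp add: gaussian_variable_def)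
  obtain \<mu> where \<mu>: "distr M borel X = return borel \<mu> \<or>
          (\<exists>\<sigma>>0. distributed M lborel X (\<lambda>x. ennreal (normal_density \<mu> \<sigma> x)))"
    using X by (auto simp: gaussian_variable_def)
  then have "?int \<and> ?cent"
  proof
    assume "distr M borel X = return borel \<mu>"
    moreover have "AE x in return borel \<mu>. x = \<mu>" by (subst AE_return) auto
    ultimately have "AE x in distr M borel X. x = \<mu>" by (simp only:)
    then have ae: "AE w in M. X w = \<mu>" by (subst (asm) AE_distr_iff) auto
    have "expectation X = expectation (\<lambda>_. \<mu>)" using ae by (intro integral_cong_AE) auto
    then have e: "expectation X = \<mu>" by (simp add: prob_space)
    have "integrable M (\<lambda>w. (X w)\<^sup>2) \<longleftrightarrow> integrable M (\<lambda>w. \<mu>\<^sup>2)"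
      using ae by (intro integrable_cong_AE) auto
    moreover have "centered_gaussian M (\<lambda>_. 0)"
      by (simp add: centered_gaussian_def prob_space)
    then have "centered_gaussian M (\<lambda>w. X w - expectation X)"
      by (rule centered_gaussian_cong_AE) (use ae e in auto)
    ultimately show ?thesis by simp
  next
    assume "\<exists>\<sigma>>0. distributed M lborel X (\<lambda>x. ennreal (normal_density \<mu> \<sigma> x))"
    then obtain \<sigma> where \<sigma>: "\<sigma> > 0" and D: "distributed M lborel X (\<lambda>x. ennreal (normal_density \<mu> \<sigma> x))"
      by blast
    have e: "expectation X = \<mu>" using normal_distributed_expectation[OF \<sigma> D] .
    have v: "variance X = \<sigma>\<^sup>2" using normal_distributed_variance[OF \<sigma> D] .
    have i2: "integrable M (\<lambda>w. (X w - \<mu>)\<^sup>2)"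
      using distributed_integrable[OF D, of "\<lambda>x. (x - \<mu>)\<^sup>2"] integrable_normal_moment[OF \<sigma>, of \<mu> 2] by simp
    have i1: "integrable M (\<lambda>w. X w - \<mu>)"
      by (rule integrable_of_square_integrable[OF _ i2]) measurable
    have "integrable M (\<lambda>w. (X w - \<mu>)\<^sup>2 + (2 * \<mu> * (X w - \<mu>) + \<mu>\<^sup>2))"
      using i1 i2 by (intro Bochner_Integration.integrable_add integrable_mult_right) auto
    moreover have "(X w - \<mu>)\<^sup>2 + (2 * \<mu> * (X w - \<mu>) + \<mu>\<^sup>2) = (X w)\<^sup>2" for w
      by (simp add: power2_eq_square algebra_simps)
    ultimately have int: ?int by simp
    have S: "distributed M lborel (\<lambda>w. (X w - \<mu>) / \<sigma>) std_normal_density"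
      using D normal_standard_normal_convert[OF \<sigma>] by blast
    have dS: "distr M borel (\<lambda>w. (X w - \<mu>) / \<sigma>) = std_normal_distribution"
      using distributed_distr_eq_density[OF S] by (simp cong: distr_cong)
    have "(CLINT w|M. iexp (r * (X w - \<mu>))) = of_real (exp (- (r\<^sup>2 * \<sigma>\<^sup>2 / 2)))" for r
    proof -
      have "(CLINT w|M. iexp (r * (X w - \<mu>))) = (CLINT w|M. iexp ((r * \<sigma>) * ((X w - \<mu>) / \<sigma>)))"
        using \<sigma> by simp
      also have "\<dots> = char (distr M borel (\<lambda>w. (X w - \<mu>) / \<sigma>)) (r * \<sigma>)"
        unfolding char_def by (subst integral_distr) auto
      also have "\<dots> = of_real (exp (- (r * \<sigma>)\<^sup>2 / 2))"
        unfolding dS char_std_normal_distribution ..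
      finally show ?thesis by (simp add: power_mult_distrib)
    qed
    then have ?cent using i2 v e by (simp add: centered_gaussian_def)
    with int show ?thesis by simp
  qed
  then show ?int ?cent by auto
qed

text \<open>
  Under \<open>L\<^sup>2\<close> convergence the second moments converge by the Cauchy-Schwarz inequality, and the
  characteristic functions converge because \<open>\<theta> \<mapsto> exp (\<i>\<theta>)\<close> is Lipschitz.
\<close>

lemma centered_gaussian_L2_limit:
  assumes X: "\<And>n. centered_gaussian M (X n)"
    and [measurable]: "L \<in> borel_measurable M" and L2: "integrable M (\<lambda>w. (L w)\<^sup>2)"
    and lim: "(\<lambda>n. expectation (\<lambda>w. (L w - X n w)\<^sup>2)) \<longlonglongrightarrow> 0"
  shows "centered_gaussian M L"
proof -
  have [measurable]: "X n \<in> borel_measurable M" and X2: "integrable M (\<lambda>w. (X n w)\<^sup>2)" for n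
    using X by (auto simp: centered_gaussian_def)
  define D where "D = (\<lambda>n w. L w - X n w)"
  have [measurable]: "D n \<in> borel_measurable M" for n unfolding D_def by simp
  have D2: "integrable M (\<lambda>w. (D n w)\<^sup>2)" for n
  proof -
    have "integrable M (\<lambda>w. (L w)\<^sup>2 + (X n w)\<^sup>2 - 2 * (L w * X n w))"
      using L2 X2[of n] by (intro Bochner_Integration.integrable_add Bochner_Integration.integrable_diff
          integrable_mult_right integrable_mult_of_square_integrable) auto
    then show ?thesis by (simp add: D_def power2_eq_square algebra_simps)
  qed
  have D0: "(\<lambda>n. sqrt (expectation (\<lambda>w. (D n w)\<^sup>2))) \<longlonglongrightarrow> 0"
    using tendsto_real_sqrt[OF lim] by (simp add: D_def)
  have LD0: "(\<lambda>n. expectation (\<lambda>w. L w * D n w)) \<longlonglongrightarrow> 0"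
  proof (rule Lim_null_comparison)
    show "(\<lambda>n. sqrt (expectation (\<lambda>w. (L w)\<^sup>2)) * sqrt (expectation (\<lambda>w. (D n w)\<^sup>2))) \<longlonglongrightarrow> 0"
      using tendsto_mult_right_zero[OF D0] .
    have "norm (expectation (\<lambda>w. L w * D n w)) \<le> expectation (\<lambda>w. \<bar>L w * D n w\<bar>)" for n
      by (rule order_trans[OF integral_norm_bound]) simp
    then show "\<forall>\<^sub>F n in sequentially. norm (expectation (\<lambda>w. L w * D n w))
        \<le> sqrt (expectation (\<lambda>w. (L w)\<^sup>2)) * sqrt (expectation (\<lambda>w. (D n w)\<^sup>2))"
      by (intro always_eventually allI order_trans[OF _ Cauchy_Schwarz_integral] D2 L2) auto
  qed
  have "expectation (\<lambda>w. (X n w)\<^sup>2) = expectation (\<lambda>w. (L w)\<^sup>2)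
      - 2 * expectation (\<lambda>w. L w * D n w) + expectation (\<lambda>w. (D n w)\<^sup>2)" for n
  proof -
    have "expectation (\<lambda>w. (X n w)\<^sup>2) = expectation (\<lambda>w. (L w)\<^sup>2 - 2 * (L w * D n w) + (D n w)\<^sup>2)"
      by (intro Bochner_Integration.integral_cong) (auto simp: D_def power2_eq_square algebra_simps)
    also have "\<dots> = expectation (\<lambda>w. (L w)\<^sup>2)
      - 2 * expectation (\<lambda>w. L w * D n w) + expectation (\<lambda>w. (D n w)\<^sup>2)"
      using L2 D2[of n] integrable_mult_of_square_integrable[OF _ _ L2 D2[of n]] by simp
    finally show ?thesis .
  qed
  moreover have "(\<lambda>n. expectation (\<lambda>w. (L w)\<^sup>2)
      - 2 * expectation (\<lambda>w. L w * D n w) + expectation (\<lambda>w. (D n w)\<^sup>2))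
      \<longlonglongrightarrow> expectation (\<lambda>w. (L w)\<^sup>2) - 2 * 0 + 0"
    using LD0 lim by (intro tendsto_intros) (auto simp: D_def)
  ultimately have var: "(\<lambda>n. expectation (\<lambda>w. (X n w)\<^sup>2)) \<longlonglongrightarrow> expectation (\<lambda>w. (L w)\<^sup>2)"
    by simp
  have "(CLINT w|M. iexp (r * L w)) = of_real (exp (- (r\<^sup>2 * expectation (\<lambda>w. (L w)\<^sup>2) / 2)))" for r
  proof (rule LIMSEQ_unique)
    have "(\<lambda>n. (CLINT w|M. iexp (r * X n w)) - (CLINT w|M. iexp (r * L w))) \<longlonglongrightarrow> 0"
    proof (rule Lim_null_comparison)
      show "(\<lambda>n. \<bar>r\<bar> * sqrt (expectation (\<lambda>w. (D n w)\<^sup>2))) \<longlonglongrightarrow> 0"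
        using tendsto_mult_right_zero[OF D0] .
      have "norm ((CLINT w|M. iexp (r * X n w)) - (CLINT w|M. iexp (r * L w)))
          \<le> \<bar>r\<bar> * sqrt (expectation (\<lambda>w. (D n w)\<^sup>2))" for n
      proof -
        have i: "integrable M (\<lambda>w. iexp (r * X n w))" "integrable M (\<lambda>w. iexp (r * L w))"
          by (intro integrable_iexp; simp)+
        have pt: "norm (iexp (r * X n w) - iexp (r * L w)) \<le> \<bar>r\<bar> * \<bar>D n w * 1\<bar>" for w
        proof -
          have "iexp (r * X n w) - iexp (r * L w) = iexp (r * L w) * (iexp (- (r * D n w)) - 1)"
            by (simp add: D_def algebra_simps flip: exp_add)
          then have "norm (iexp (r * X n w) - iexp (r * L w)) = norm (iexp (- (r * D n w)) - 1)"
            by (simp add: norm_mult del: of_real_mult of_real_minus)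
          also have "\<dots> \<le> \<bar>- (r * D n w)\<bar>"
            using iexp_approx1[of "- (r * D n w)" 0] by simp
          finally show ?thesis by (simp add: abs_mult)
        qed
        have "norm ((CLINT w|M. iexp (r * X n w)) - (CLINT w|M. iexp (r * L w)))
            = norm (CLINT w|M. iexp (r * X n w) - iexp (r * L w))"
          by (simp only: Bochner_Integration.integral_diff[OF i])
        also have "\<dots> \<le> expectation (\<lambda>w. norm (iexp (r * X n w) - iexp (r * L w)))"
          by (rule integral_norm_bound)
        also have "\<dots> \<le> expectation (\<lambda>w. \<bar>r\<bar> * \<bar>D n w * 1\<bar>)"
          using i integrable_of_square_integrable[OF _ D2[of n]] pt
          by (intro integral_mono integrable_norm Bochner_Integration.integrable_diff) auto
        also have "\<dots> = \<bar>r\<bar> * expectation (\<lambda>w. \<bar>D n w * 1\<bar>)" by simp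
        also have "\<dots> \<le> \<bar>r\<bar> * (sqrt (expectation (\<lambda>w. (D n w)\<^sup>2)) * sqrt (expectation (\<lambda>w. 1\<^sup>2)))"
          by (intro mult_left_mono Cauchy_Schwarz_integral D2) auto
        finally show ?thesis by (simp add: prob_space)
      qed
      then show "\<forall>\<^sub>F n in sequentially. norm ((CLINT w|M. iexp (r * X n w)) - (CLINT w|M. iexp (r * L w)))
          \<le> \<bar>r\<bar> * sqrt (expectation (\<lambda>w. (D n w)\<^sup>2))" by simp
    qed
    then show "(\<lambda>n. CLINT w|M. iexp (r * X n w)) \<longlonglongrightarrow> (CLINT w|M. iexp (r * L w))"
      by (simp add: LIM_zero_iff)
    have "(CLINT w|M. iexp (r * X n w)) = of_real (exp (- (r\<^sup>2 * expectation (\<lambda>w. (X n w)\<^sup>2) / 2)))" for n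
      using X[of n] by (simp add: centered_gaussian_def)
    then show "(\<lambda>n. CLINT w|M. iexp (r * X n w))
        \<longlonglongrightarrow> of_real (exp (- (r\<^sup>2 * expectation (\<lambda>w. (L w)\<^sup>2) / 2)))"
      by (simp only:) (intro tendsto_intros var, simp)
  qed
  then show ?thesis using L2 by (simp add: centered_gaussian_def)
qed

end

section \<open>Integrals of Gaussian processes\<close>

text \<open>
  Maurey's empirical method in a greedy form. If \<open>\<tau>\<close> is drawn from \<open>P\<close>, then \<open>L - g \<tau>\<close> has mean zero
  for almost every outcome \<open>w\<close>, so adding it to the current error \<open>n L - S\<close> increases the mean squared
  error, averaged over \<open>\<tau>\<close>, by at most \<open>K\<close>: the cross term vanishes. Hence some \<open>\<tau>\<close> does no worse than
  the average. The predicate \<open>V\<close> stands for any class of functions that contains all the partial sums.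
\<close>

lemma L2_approx_by_sampling:
  fixes g :: "'t \<Rightarrow> 'w \<Rightarrow> real" and V :: "('w \<Rightarrow> real) \<Rightarrow> bool" and L :: "'w \<Rightarrow> real" and K :: real and n :: nat
  assumes M: "prob_space M" and P: "prob_space P"
    and g [measurable]: "(\<lambda>(\<tau>, w). g \<tau> w) \<in> borel_measurable (P \<Otimes>\<^sub>M M)"
    and g2: "\<And>\<tau>. \<tau> \<in> space P \<Longrightarrow> integrable M (\<lambda>w. (g \<tau> w)\<^sup>2)"
    and gK: "\<And>\<tau>. \<tau> \<in> space P \<Longrightarrow> (LINT w|M. (g \<tau> w)\<^sup>2) \<le> K"
    and V0: "V (\<lambda>_. 0)"
    and Vadd: "\<And>S \<tau>. V S \<Longrightarrow> \<tau> \<in> space P \<Longrightarrow> V (\<lambda>w. S w + g \<tau> w)"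
    and V2: "\<And>S. V S \<Longrightarrow> S \<in> borel_measurable M \<and> integrable M (\<lambda>w. (S w)\<^sup>2)"
  defines "L \<equiv> \<lambda>w. LINT \<tau>|P. g \<tau> w"
  shows "integrable M (\<lambda>w. (L w)\<^sup>2)"
    and "\<exists>S. V S \<and> (LINT w|M. (n * L w - S w)\<^sup>2) \<le> n * K"
proof -
  interpret M: prob_space M by fact
  interpret P: prob_space P by fact
  interpret PM: pair_sigma_finite P M ..
  interpret MP: pair_sigma_finite M P ..
  have [measurable]: "(\<lambda>(w, \<tau>). g \<tau> w) \<in> borel_measurable (M \<Otimes>\<^sub>M P)"
    using measurable_compose[OF measurable_pair_swap' g] by (simp add: case_prod_beta')
  have [measurable]: "L \<in> borel_measurable M" unfolding L_def by measurable
  have [measurable]: "g \<tau> \<in> borel_measurable M" if "\<tau> \<in> space P" for \<tau>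
    using that by measurable
  have g2PM: "integrable (P \<Otimes>\<^sub>M M) (\<lambda>(\<tau>, w). (g \<tau> w)\<^sup>2)"
  proof (rule PM.Fubini_integrable)
    show "(\<lambda>(\<tau>, w). (g \<tau> w)\<^sup>2) \<in> borel_measurable (P \<Otimes>\<^sub>M M)" by measurable
    show "AE \<tau> in P. integrable M (\<lambda>w. case (\<tau>, w) of (\<tau>, w) \<Rightarrow> (g \<tau> w)\<^sup>2)"
      using g2 by (auto intro: AE_I2)
    have "integrable P (\<lambda>\<tau>. LINT w|M. (g \<tau> w)\<^sup>2)"
    proof (rule P.integrable_const_bound)
      show "AE \<tau> in P. norm (LINT w|M. (g \<tau> w)\<^sup>2) \<le> K"
        using gK by (auto intro: AE_I2)
    qed measurable
    then show "integrable P (\<lambda>\<tau>. LINT w|M. norm (case (\<tau>, w) of (\<tau>, w) \<Rightarrow> (g \<tau> w)\<^sup>2))"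
      by simp
  qed
  have g2MP: "integrable (M \<Otimes>\<^sub>M P) (\<lambda>(w, \<tau>). (g \<tau> w)\<^sup>2)"
    using PM.integrable_product_swap[OF g2PM] by (simp add: case_prod_beta')
  define Q where "Q = (\<lambda>w. LINT \<tau>|P. (g \<tau> w)\<^sup>2)"
  have Qint: "integrable M Q"
    unfolding Q_def using MP.integrable_fst'[OF g2MP] by simp
  have "(LINT w|M. Q w) = (LINT \<tau>|P. LINT w|M. (g \<tau> w)\<^sup>2)"
    unfolding Q_def using PM.Fubini_integral[of "\<lambda>\<tau> w. (g \<tau> w)\<^sup>2"] g2PM by (simp add: case_prod_beta')
  also have "\<dots> \<le> (LINT \<tau>|P. K)"
    using PM.integrable_fst'[OF g2PM] gK by (intro integral_mono) auto
  finally have QK: "(LINT w|M. Q w) \<le> K" by (simp add: P.prob_space)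
  have g2w: "AE w in M. integrable P (\<lambda>\<tau>. (g \<tau> w)\<^sup>2)"
    using MP.AE_integrable_fst'[OF g2MP] by simp
  have LQ: "AE w in M. (L w)\<^sup>2 \<le> Q w"
    using g2w AE_space
  proof eventually_elim
    case (elim w)
    have [measurable]: "(\<lambda>\<tau>. g \<tau> w) \<in> borel_measurable P" using elim by measurable
    have "\<bar>L w\<bar> \<le> (LINT \<tau>|P. \<bar>g \<tau> w * 1\<bar>)" unfolding L_def by simp
    also have "\<dots> \<le> sqrt (Q w) * sqrt (LINT \<tau>|P. 1\<^sup>2)"
      unfolding Q_def using elim by (intro Cauchy_Schwarz_integral) auto
    finally have "\<bar>L w\<bar> \<le> sqrt (Q w)" by (simp add: P.prob_space)
    moreover have "0 \<le> Q w" unfolding Q_def by simp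
    ultimately show ?case by (metis abs_ge_zero power2_abs power_mono real_sqrt_pow2)
  qed
  show L2: "integrable M (\<lambda>w. (L w)\<^sup>2)"
    using Qint by (rule Bochner_Integration.integrable_bound) (use LQ in auto)
  show "\<exists>S. V S \<and> (LINT w|M. (n * L w - S w)\<^sup>2) \<le> n * K"
  proof (induction n)
    case 0
    then show ?case using V0 by (intro exI[of _ "\<lambda>_. 0"]) simp
  next
    case (Suc n)
    then obtain S where S: "V S" and IH: "(LINT w|M. (n * L w - S w)\<^sup>2) \<le> n * K" by auto
    have [measurable]: "S \<in> borel_measurable M" and S2: "integrable M (\<lambda>w. (S w)\<^sup>2)"
      using V2[OF S] by auto
    have square_diff: "integrable N (\<lambda>x. (a x - b x)\<^sup>2)"
      if "integrable N (\<lambda>x. (a x)\<^sup>2)" "integrable N (\<lambda>x. (b x)\<^sup>2)"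
        "a \<in> borel_measurable N" "b \<in> borel_measurable N" for N :: "'c measure" and a b :: "'c \<Rightarrow> real"
    proof -
      have "integrable N (\<lambda>x. (a x)\<^sup>2 + (b x)\<^sup>2 - 2 * (a x * b x))"
        using that by (intro Bochner_Integration.integrable_add Bochner_Integration.integrable_diff
            integrable_mult_right integrable_mult_of_square_integrable) auto
      then show ?thesis by (simp add: power2_eq_square algebra_simps)
    qed
    define e where "e = (\<lambda>w. n * L w - S w)"
    have [measurable]: "e \<in> borel_measurable M" unfolding e_def by measurable
    have e2: "integrable M (\<lambda>w. (e w)\<^sup>2)"
      unfolding e_def using L2 S2 by (intro square_diff) (auto simp: power_mult_distrib)
    \<comment> \<open>\<open>e\<close> is the error after \<open>n\<close> samples; after one more sample \<open>\<tau>\<close> it becomes \<open>a - g \<tau>\<close>.\<close>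
    define a where "a = (\<lambda>w. Suc n * L w - S w)"
    have [measurable]: "a \<in> borel_measurable M" unfolding a_def by measurable
    have a2: "integrable M (\<lambda>w. (a w)\<^sup>2)"
      unfolding a_def using L2 S2 by (intro square_diff) (auto simp: power_mult_distrib simp del: of_nat_Suc)
    have a2PM: "integrable (P \<Otimes>\<^sub>M M) (\<lambda>p. (a (snd p))\<^sup>2)"
    proof (rule PM.Fubini_integrable)
      show "integrable P (\<lambda>\<tau>. LINT w|M. norm ((a (snd (\<tau>, w)))\<^sup>2))" by simp
    qed (use a2 in auto)
    have ag2: "integrable (P \<Otimes>\<^sub>M M) (\<lambda>(\<tau>, w). (a w - g \<tau> w)\<^sup>2)"
      using square_diff[OF a2PM, of "\<lambda>(\<tau>, w). g \<tau> w"] g2PM by (simp add: case_prod_beta')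
    have "(LINT \<tau>|P. LINT w|M. (a w - g \<tau> w)\<^sup>2) = (LINT w|M. LINT \<tau>|P. (a w - g \<tau> w)\<^sup>2)"
      using PM.Fubini_integral[of "\<lambda>\<tau> w. (a w - g \<tau> w)\<^sup>2"] ag2 by (simp add: case_prod_beta')
    also have "\<dots> \<le> (LINT w|M. (e w)\<^sup>2 + Q w)"
    proof (rule integral_mono_AE)
      show "integrable M (\<lambda>w. LINT \<tau>|P. (a w - g \<tau> w)\<^sup>2)"
        using MP.integrable_fst'[OF PM.integrable_product_swap[OF ag2]] by simp
      show "integrable M (\<lambda>w. (e w)\<^sup>2 + Q w)" using e2 Qint by simp
      show "AE w in M. (LINT \<tau>|P. (a w - g \<tau> w)\<^sup>2) \<le> (e w)\<^sup>2 + Q w"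
        using g2w AE_space
      proof eventually_elim
        case (elim w)
        have [measurable]: "(\<lambda>\<tau>. g \<tau> w) \<in> borel_measurable P" using elim by measurable
        have g1: "integrable P (\<lambda>\<tau>. g \<tau> w)"
          using elim(1) by (rule P.integrable_of_square_integrable[rotated]) measurable
        have "(LINT \<tau>|P. (a w - g \<tau> w)\<^sup>2) = (LINT \<tau>|P. (a w)\<^sup>2 - 2 * a w * g \<tau> w + (g \<tau> w)\<^sup>2)"
          by (simp add: power2_eq_square algebra_simps)
        also have "\<dots> = (a w)\<^sup>2 - 2 * a w * L w + Q w"
          using g1 elim by (simp add: L_def Q_def P.prob_space)
        also have "\<dots> = (e w)\<^sup>2 - (L w)\<^sup>2 + Q w"
          by (simp add: a_def e_def power2_eq_square algebra_simps)
        finally show ?case by simp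
      qed
    qed
    also have "\<dots> = (LINT w|M. (e w)\<^sup>2) + (LINT w|M. Q w)"
      using e2 Qint by simp
    also have "\<dots> \<le> Suc n * K"
      using IH QK by (simp add: e_def algebra_simps)
    finally have avg: "(LINT \<tau>|P. LINT w|M. (a w - g \<tau> w)\<^sup>2) \<le> Suc n * K" .
    have "\<exists>\<tau>\<in>space P. (LINT w|M. (a w - g \<tau> w)\<^sup>2) \<le> Suc n * K"
    proof (rule ccontr)
      assume "\<not> ?thesis"
      then have "AE \<tau> in P. Suc n * K < (LINT w|M. (a w - g \<tau> w)\<^sup>2)"
        by (intro AE_I2) force
      then have "Suc n * K < (LINT \<tau>|P. LINT w|M. (a w - g \<tau> w)\<^sup>2)"
        using PM.integrable_fst'[OF ag2] by (intro P.expectation_greater) auto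
      with avg show False by simp
    qed
    then obtain \<tau> where \<tau>: "\<tau> \<in> space P" "(LINT w|M. (a w - g \<tau> w)\<^sup>2) \<le> Suc n * K" by blast
    show ?case
    proof (intro exI conjI)
      show "V (\<lambda>w. S w + g \<tau> w)" using Vadd[OF S \<tau>(1)] .
      show "(LINT w|M. (Suc n * L w - (S w + g \<tau> w))\<^sup>2) \<le> Suc n * K"
        using \<tau>(2) by (simp add: a_def algebra_simps)
    qed
  qed
qed

text \<open>
  Normalising \<open>|k|\<close> to a probability density turns the integral into a mean of multiples of the values
  of the process, so that sampling approximates it by finite linear combinations with \<open>L\<^sup>2\<close> error
  \<open>O(1/n)\<close>.
\<close>

lemma (in prob_space) centered_gaussian_integral:
  fixes \<Phi> :: "'t \<Rightarrow> 'a \<Rightarrow> real" and k :: "'t \<Rightarrow> real"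
  assumes N: "sigma_finite_measure N"
    and \<Phi> [measurable]: "(\<lambda>(\<tau>, w). \<Phi> \<tau> w) \<in> borel_measurable (N \<Otimes>\<^sub>M M)"
    and gauss: "\<And>T a. finite T \<Longrightarrow> centered_gaussian M (\<lambda>w. \<Sum>t\<in>T. a t * \<Phi> t w)"
    and K: "\<And>\<tau>. expectation (\<lambda>w. (\<Phi> \<tau> w)\<^sup>2) \<le> K"
    and k: "integrable N k"
  shows "centered_gaussian M (\<lambda>w. LINT \<tau>|N. k \<tau> * \<Phi> \<tau> w)"
proof -
  have [measurable]: "k \<in> borel_measurable N" using k by simp
  define \<kappa> where "\<kappa> = (LINT \<tau>|N. \<bar>k \<tau>\<bar>)"
  show ?thesis
  proof (cases "\<kappa> = 0")
    case True
    then have "AE \<tau> in N. k \<tau> = 0"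
      using k by (simp add: \<kappa>_def integral_nonneg_eq_0_iff_AE)
    then have "(LINT \<tau>|N. k \<tau> * \<Phi> \<tau> w) = 0" for w
      by (intro integral_eq_zero_AE) auto
    then show ?thesis using gauss[of "{}"] by simp
  next
    case False
    moreover have "0 \<le> \<kappa>" by (simp add: \<kappa>_def)
    ultimately have \<kappa>: "\<kappa> > 0" by simp
    define P where "P = density N (\<lambda>\<tau>. ennreal (\<bar>k \<tau>\<bar> / \<kappa>))"
    have [measurable_cong]: "sets P = sets N" by (simp add: P_def)
    have spP: "space P = space N" by (simp add: P_def)
    have P: "prob_space P"
    proof (rule prob_spaceI)
      have "emeasure P (space P) = (\<integral>\<^sup>+\<tau>. ennreal (\<bar>k \<tau>\<bar> / \<kappa>) \<partial>N)"
        unfolding P_def by (subst emeasure_density) (auto intro!: nn_integral_cong)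
      also have "\<dots> = ennreal (LINT \<tau>|N. \<bar>k \<tau>\<bar> / \<kappa>)"
        using k \<kappa> by (intro nn_integral_eq_integral) auto
      also have "\<dots> = 1" using \<kappa> by (simp add: \<kappa>_def[symmetric])
      finally show "emeasure P (space P) = 1" .
    qed
    interpret P: prob_space P by (rule P)
    define g where "g = (\<lambda>\<tau> w. \<kappa> * sgn (k \<tau>) * \<Phi> \<tau> w)"
    have g [measurable]: "(\<lambda>(\<tau>, w). g \<tau> w) \<in> borel_measurable (P \<Otimes>\<^sub>M M)"
      unfolding g_def by measurable
    have \<Phi>2: "integrable M (\<lambda>w. (\<Phi> \<tau> w)\<^sup>2)" for \<tau>
      using gauss[of "{\<tau>}" "\<lambda>_. 1"] by (simp add: centered_gaussian_def)
    have K0: "0 \<le> K" by (rule order_trans[OF Bochner_Integration.integral_nonneg K]) simp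
    define V where "V = (\<lambda>S. \<exists>T a. finite T \<and> S = (\<lambda>w. \<Sum>t\<in>T. a t * \<Phi> t w))"
    define L where "L = (\<lambda>w. LINT \<tau>|P. g \<tau> w)"
    have g2: "integrable M (\<lambda>w. (g \<tau> w)\<^sup>2)" for \<tau>
      using \<Phi>2 by (simp add: g_def power_mult_distrib)
    have gK: "expectation (\<lambda>w. (g \<tau> w)\<^sup>2) \<le> \<kappa>\<^sup>2 * K" for \<tau>
    proof -
      have "(sgn (k \<tau>))\<^sup>2 * expectation (\<lambda>w. (\<Phi> \<tau> w)\<^sup>2) \<le> 1 * K"
        using K[of \<tau>] K0 by (cases "k \<tau> = 0") (auto simp: sgn_if)
      then show ?thesis
        by (simp add: g_def power_mult_distrib mult.assoc mult_left_mono)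
    qed
    have V0: "V (\<lambda>_. 0)" unfolding V_def by (intro exI[of _ "{}"]) simp
    have Vadd: "V (\<lambda>w. S w + g \<tau> w)" if S: "V S" for S \<tau>
    proof -
      obtain T a where T: "finite T" and S: "S = (\<lambda>w. \<Sum>t\<in>T. a t * \<Phi> t w)"
        using S by (auto simp: V_def)
      define b where "b = (\<lambda>t. (if t \<in> T then a t else 0) + (if t = \<tau> then \<kappa> * sgn (k \<tau>) else 0))"
      have "S w + g \<tau> w = (\<Sum>t\<in>insert \<tau> T. b t * \<Phi> t w)" for w
      proof -
        have "(\<Sum>t\<in>insert \<tau> T. b t * \<Phi> t w) = (\<Sum>t\<in>insert \<tau> T. (if t \<in> T then a t * \<Phi> t w else 0))
            + (\<Sum>t\<in>insert \<tau> T. (if t = \<tau> then g \<tau> w else 0))"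
          unfolding sum.distrib[symmetric] by (intro sum.cong) (auto simp: b_def g_def algebra_simps)
        also have "(\<Sum>t\<in>insert \<tau> T. (if t \<in> T then a t * \<Phi> t w else 0)) = S w"
          unfolding S using T by (intro sum.mono_neutral_cong_right) auto
        also have "(\<Sum>t\<in>insert \<tau> T. (if t = \<tau> then g \<tau> w else 0)) = g \<tau> w"
          using T by simp
        finally show ?thesis by simp
      qed
      then show ?thesis unfolding V_def using T by blast
    qed
    have Vgauss: "centered_gaussian M (\<lambda>w. r * S w)" if S: "V S" for S r
    proof -
      obtain T a where T: "finite T" and S: "S = (\<lambda>w. \<Sum>t\<in>T. a t * \<Phi> t w)"
        using S by (auto simp: V_def)
      show ?thesis using gauss[OF T, of "\<lambda>t. r * a t"]
        by (simp add: S sum_distrib_left mult.assoc)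
    qed
    have V2: "S \<in> borel_measurable M \<and> integrable M (\<lambda>w. (S w)\<^sup>2)" if "V S" for S
      using Vgauss[OF that, of 1] by (simp add: centered_gaussian_def)
    have "\<exists>S. V S \<and> expectation (\<lambda>w. (real n * L w - S w)\<^sup>2) \<le> real n * (\<kappa>\<^sup>2 * K)" for n
      unfolding L_def
      by (rule L2_approx_by_sampling(2)[where V = V, OF prob_space_axioms P g]) (use g2 gK V0 Vadd V2 in auto)
    then obtain S where S: "\<And>n. V (S n)"
      and SL: "\<And>n. expectation (\<lambda>w. (real n * L w - S n w)\<^sup>2) \<le> real n * (\<kappa>\<^sup>2 * K)"
      by metis
    have L2: "integrable M (\<lambda>w. (L w)\<^sup>2)"
      unfolding L_def
      by (rule L2_approx_by_sampling(1)[where V = V, OF prob_space_axioms P g]) (use g2 gK V0 Vadd V2 in auto)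
    have "(\<lambda>(w, \<tau>). g \<tau> w) \<in> borel_measurable (M \<Otimes>\<^sub>M P)"
      using measurable_compose[OF measurable_pair_swap' g] by (simp add: case_prod_beta')
    then have [measurable]: "L \<in> borel_measurable M" unfolding L_def by measurable
    have L: "centered_gaussian M L"
    proof (rule centered_gaussian_L2_limit)
      show "centered_gaussian M (\<lambda>w. (1 / real (Suc n)) * S (Suc n) w)" for n
        by (rule Vgauss[OF S])
      show "(\<lambda>n. expectation (\<lambda>w. (L w - 1 / real (Suc n) * S (Suc n) w)\<^sup>2)) \<longlonglongrightarrow> 0"
      proof (rule Lim_null_comparison)
        show "(\<lambda>n. (\<kappa>\<^sup>2 * K) * (1 / real (Suc n))) \<longlonglongrightarrow> 0"
          by (rule tendsto_mult_right_zero) (use LIMSEQ_inverse_real_of_nat in \<open>simp add: inverse_eq_divide\<close>)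
        have "norm (expectation (\<lambda>w. (L w - 1 / real (Suc n) * S (Suc n) w)\<^sup>2))
            \<le> (\<kappa>\<^sup>2 * K) * (1 / real (Suc n))" for n
        proof -
          have "L w - 1 / real (Suc n) * S (Suc n) w
              = 1 / real (Suc n) * (real (Suc n) * L w - S (Suc n) w)" for w
            by (simp add: right_diff_distrib del: of_nat_Suc)
          then have "expectation (\<lambda>w. (L w - 1 / real (Suc n) * S (Suc n) w)\<^sup>2)
              = (1 / real (Suc n))\<^sup>2 * expectation (\<lambda>w. (real (Suc n) * L w - S (Suc n) w)\<^sup>2)"
            by (simp only: power_mult_distrib integral_mult_right_zero)
          also have "\<dots> \<le> (1 / real (Suc n))\<^sup>2 * (real (Suc n) * (\<kappa>\<^sup>2 * K))"
            by (intro mult_left_mono SL) simp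
          also have "\<dots> = (\<kappa>\<^sup>2 * K) * (1 / real (Suc n))"
            by (simp add: power2_eq_square del: of_nat_Suc)
          finally show ?thesis by simp
        qed
        then show "\<forall>\<^sub>F n in sequentially. norm (expectation (\<lambda>w. (L w - 1 / real (Suc n) * S (Suc n) w)\<^sup>2))
            \<le> (\<kappa>\<^sup>2 * K) * (1 / real (Suc n))" by simp
      qed
    qed (use L2 in auto)
    have eq: "L w = (LINT \<tau>|N. k \<tau> * \<Phi> \<tau> w)" if "w \<in> space M" for w
    proof -
      have [measurable]: "(\<lambda>\<tau>. \<Phi> \<tau> w) \<in> borel_measurable N" using that by measurable
      have "L w = (LINT \<tau>|N. (\<bar>k \<tau>\<bar> / \<kappa>) *\<^sub>R (\<kappa> * sgn (k \<tau>) * \<Phi> \<tau> w))"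
        unfolding L_def P_def g_def using \<kappa> by (subst integral_density) auto
      also have "\<dots> = (LINT \<tau>|N. k \<tau> * \<Phi> \<tau> w)"
        using \<kappa> by (intro Bochner_Integration.integral_cong) (auto simp: sgn_if)
      finally show ?thesis .
    qed
    have "(\<lambda>w. LINT \<tau>|N. k \<tau> * \<Phi> \<tau> w) \<in> borel_measurable M"
      using eq by (subst measurable_cong[where g = L]) auto
    then show ?thesis
      by (rule centered_gaussian_cong_AE[OF L]) (use eq in \<open>auto intro: AE_I2\<close>)
  qed
qed

section \<open>The standard normal distribution on the line and in the plane\<close>

text \<open>
  Up to a factor the integrand is again a normal density, of variance \<open>1 / (1 - a)\<close>. Negative \<open>a\<close> gives
  the Laplace transform of the square of a normal variable, positive \<open>a\<close> its exponential moments.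
\<close>

lemma nn_integral_std_normal_exp_square:
  fixes a :: real
  assumes a: "a < 1"
  shows "(\<integral>\<^sup>+x. ennreal (exp (a * x\<^sup>2 / 2)) \<partial>std_normal_distribution) = ennreal (1 / sqrt (1 - a))"
proof -
  define \<sigma> where "\<sigma> = 1 / sqrt (1 - a)"
  have \<sigma>: "\<sigma> > 0" and \<sigma>2: "\<sigma>\<^sup>2 = 1 / (1 - a)"
    using a by (auto simp: \<sigma>_def power_divide)
  have eq: "std_normal_density x * exp (a * x\<^sup>2 / 2) = \<sigma> * normal_density 0 \<sigma> x" for x
  proof -
    have "exp (- x\<^sup>2 / 2) * exp (a * x\<^sup>2 / 2) = exp (- x\<^sup>2 / (2 * \<sigma>\<^sup>2))"
      unfolding exp_add[symmetric] \<sigma>2 by (simp add: field_simps)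
    then show ?thesis
      using \<sigma> by (simp add: normal_density_def real_sqrt_mult)
  qed
  have "(\<integral>\<^sup>+x. ennreal (exp (a * x\<^sup>2 / 2)) \<partial>std_normal_distribution)
      = (\<integral>\<^sup>+x. ennreal (std_normal_density x * exp (a * x\<^sup>2 / 2)) \<partial>lborel)"
    by (subst nn_integral_density) (auto simp: ennreal_mult)
  also have "\<dots> = ennreal \<sigma> * (\<integral>\<^sup>+x. ennreal (normal_density 0 \<sigma> x) \<partial>lborel)"
    using \<sigma> by (simp add: eq ennreal_mult nn_integral_cmult)
  also have "(\<integral>\<^sup>+x. ennreal (normal_density 0 \<sigma> x) \<partial>lborel) = 1"
    using \<sigma> by (subst nn_integral_eq_integral) auto
  finally show ?thesis by (simp add: \<sigma>_def)
qed

text \<open>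
  The density of \<open>c N\<close> at \<open>x\<close> is \<open>1 / c\<close> times the standard density at \<open>x / c\<close>, which is at least the
  standard density at \<open>x\<close>.
\<close>

lemma nn_integral_std_normal_scale:
  fixes h :: "real \<Rightarrow> ennreal"
  assumes [measurable]: "h \<in> borel_measurable borel" and c: "1 \<le> c"
  shows "(\<integral>\<^sup>+x. h x \<partial>std_normal_distribution) \<le> ennreal c * (\<integral>\<^sup>+x. h (c * x) \<partial>std_normal_distribution)"
proof -
  have le: "std_normal_density x \<le> std_normal_density (x / c)" for x
  proof -
    have "\<bar>x / c\<bar> \<le> \<bar>x\<bar>"
      using c mult_left_mono[of 1 c "\<bar>x\<bar>"] by (simp add: abs_divide divide_le_eq)
    then have "(x / c)\<^sup>2 \<le> x\<^sup>2" by (rule abs_le_square_iff[THEN iffD1])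
    then show ?thesis by (simp add: std_normal_density_def divide_right_mono)
  qed
  have "(\<integral>\<^sup>+x. h x \<partial>std_normal_distribution) = (\<integral>\<^sup>+x. ennreal (std_normal_density x) * h x \<partial>lborel)"
    by (subst nn_integral_density) auto
  also have "\<dots> \<le> (\<integral>\<^sup>+x. ennreal (std_normal_density (x / c)) * h x \<partial>lborel)"
    using le by (intro nn_integral_mono mult_right_mono) (auto simp: ennreal_leI)
  also have "\<dots> = ennreal c * (\<integral>\<^sup>+x. ennreal (std_normal_density x) * h (c * x) \<partial>lborel)"
    using c by (subst nn_integral_real_affine[where c = c and t = 0]) auto
  also have "\<dots> = ennreal c * (\<integral>\<^sup>+x. h (c * x) \<partial>std_normal_distribution)"
    by (subst nn_integral_density) auto
  finally show ?thesis .
qed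

definition std_normal_plane :: "(real \<times> real) measure" where
  "std_normal_plane = std_normal_distribution \<Otimes>\<^sub>M std_normal_distribution"

lemma sets_std_normal_plane [measurable_cong]: "sets std_normal_plane = sets (borel \<Otimes>\<^sub>M borel)"
  unfolding std_normal_plane_def by (intro sets_pair_measure_cong) auto

lemma prob_space_std_normal_plane: "prob_space std_normal_plane"
proof -
  interpret N: real_distribution std_normal_distribution by (rule real_dist_normal_dist)
  interpret NN: pair_prob_space std_normal_distribution std_normal_distribution ..
  show ?thesis unfolding std_normal_plane_def by (rule NN.prob_space_axioms)
qed

lemma nn_integral_std_normal_plane:
  assumes "h \<in> borel_measurable (borel \<Otimes>\<^sub>M borel)"
  shows "(\<integral>\<^sup>+p. h p \<partial>std_normal_plane) =
    (\<integral>\<^sup>+u. \<integral>\<^sup>+v. h (u, v) \<partial>std_normal_distribution \<partial>std_normal_distribution)"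
proof -
  interpret N: real_distribution std_normal_distribution by (rule real_dist_normal_dist)
  have "h \<in> borel_measurable (std_normal_distribution \<Otimes>\<^sub>M std_normal_distribution)"
    using assms sets_std_normal_plane by (simp add: std_normal_plane_def cong: measurable_cong_sets)
  then show ?thesis unfolding std_normal_plane_def by (rule N.nn_integral_fst[symmetric])
qed

lemma nn_integral_std_normal_plane_scale:
  fixes h :: "real \<times> real \<Rightarrow> ennreal"
  assumes h [measurable]: "h \<in> borel_measurable (borel \<Otimes>\<^sub>M borel)" and c: "1 \<le> c"
  shows "(\<integral>\<^sup>+p. h p \<partial>std_normal_plane)
    \<le> ennreal (c\<^sup>2) * (\<integral>\<^sup>+p. h (c * fst p, c * snd p) \<partial>std_normal_plane)"
proof -
  interpret N: real_distribution std_normal_distribution by (rule real_dist_normal_dist)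
  have m: "(\<lambda>u. \<integral>\<^sup>+v. h (u, c * v) \<partial>std_normal_distribution) \<in> borel_measurable borel"
    by measurable
  have "(\<integral>\<^sup>+p. h p \<partial>std_normal_plane)
      = (\<integral>\<^sup>+u. \<integral>\<^sup>+v. h (u, v) \<partial>std_normal_distribution \<partial>std_normal_distribution)"
    by (rule nn_integral_std_normal_plane) simp
  also have "\<dots> \<le> (\<integral>\<^sup>+u. ennreal c * (\<integral>\<^sup>+v. h (u, c * v) \<partial>std_normal_distribution) \<partial>std_normal_distribution)"
    using c by (intro nn_integral_mono nn_integral_std_normal_scale) auto
  also have "\<dots> = ennreal c * (\<integral>\<^sup>+u. \<integral>\<^sup>+v. h (u, c * v) \<partial>std_normal_distribution \<partial>std_normal_distribution)"
    using m by (intro nn_integral_cmult) simp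
  also have "\<dots> \<le> ennreal c * (ennreal c * (\<integral>\<^sup>+u. \<integral>\<^sup>+v. h (c * u, c * v)
      \<partial>std_normal_distribution \<partial>std_normal_distribution))"
    by (intro mult_left_mono nn_integral_std_normal_scale m c) simp
  also have "\<dots> = ennreal (c\<^sup>2) * (\<integral>\<^sup>+u. \<integral>\<^sup>+v. h (c * u, c * v)
      \<partial>std_normal_distribution \<partial>std_normal_distribution)"
    using c by (simp add: power2_eq_square ennreal_mult mult.assoc)
  also have "(\<integral>\<^sup>+u. \<integral>\<^sup>+v. h (c * u, c * v) \<partial>std_normal_distribution \<partial>std_normal_distribution)
      = (\<integral>\<^sup>+p. h (c * fst p, c * snd p) \<partial>std_normal_plane)"
    by (subst nn_integral_std_normal_plane) auto
  finally show ?thesis .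
qed

lemma nn_integral_std_normal_plane_exp_norm:
  assumes a: "a < 1"
  shows "(\<integral>\<^sup>+p. ennreal (exp (a * ((fst p)\<^sup>2 + (snd p)\<^sup>2) / 2)) \<partial>std_normal_plane) = ennreal (1 / (1 - a))"
proof -
  have s: "exp (a * (u\<^sup>2 + v\<^sup>2) / 2) = exp (a * u\<^sup>2 / 2) * exp (a * v\<^sup>2 / 2)" for u v :: real
    by (simp add: exp_add[symmetric] field_simps)
  have "(\<integral>\<^sup>+p. ennreal (exp (a * ((fst p)\<^sup>2 + (snd p)\<^sup>2) / 2)) \<partial>std_normal_plane)
      = (\<integral>\<^sup>+u. \<integral>\<^sup>+v. ennreal (exp (a * u\<^sup>2 / 2)) * ennreal (exp (a * v\<^sup>2 / 2))
          \<partial>std_normal_distribution \<partial>std_normal_distribution)"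
    by (subst nn_integral_std_normal_plane) (auto simp: s ennreal_mult)
  also have "\<dots> = ennreal (1 / sqrt (1 - a)) * ennreal (1 / sqrt (1 - a))"
    using a by (simp add: nn_integral_cmult nn_integral_multc nn_integral_std_normal_exp_square)
  also have "\<dots> = ennreal (1 / (1 - a))"
    using a by (simp add: ennreal_mult[symmetric])
  finally show ?thesis .
qed

lemma char_std_normal_plane:
  "(CLINT p|std_normal_plane. iexp (fst p * x + snd p * y)) = of_real (exp (- ((x\<^sup>2 + y\<^sup>2) / 2)))"
proof -
  interpret N: real_distribution std_normal_distribution by (rule real_dist_normal_dist)
  interpret NN: pair_prob_space std_normal_distribution std_normal_distribution ..
  have i: "integrable (std_normal_distribution \<Otimes>\<^sub>M std_normal_distribution)
      (\<lambda>p. iexp (fst p * x + snd p * y))"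
    by (intro NN.integrable_iexp) auto
  have c: "(CLINT u|std_normal_distribution. iexp (u * x)) = of_real (exp (- (x\<^sup>2 / 2)))" for x
    using fun_cong[OF char_std_normal_distribution, of x] by (simp add: char_def mult.commute)
  have "(CLINT p|std_normal_plane. iexp (fst p * x + snd p * y))
      = (CLINT u|std_normal_distribution. CLINT v|std_normal_distribution. iexp (u * x + v * y))"
    using NN.integral_fst'[OF i] by (simp add: std_normal_plane_def)
  also have "\<dots> = (CLINT u|std_normal_distribution. CLINT v|std_normal_distribution. iexp (u * x) * iexp (v * y))"
    by (simp add: exp_add[symmetric] algebra_simps)
  also have "\<dots> = (CLINT u|std_normal_distribution. iexp (u * x)) * (CLINT v|std_normal_distribution. iexp (v * y))"
    by simp
  also have "\<dots> = of_real (exp (- ((x\<^sup>2 + y\<^sup>2) / 2)))"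
    unfolding c by (simp add: exp_add[symmetric] add_divide_distrib flip: of_real_mult)
  finally show ?thesis .
qed

section \<open>Tails of centred Gaussian vectors in the plane\<close>

context prob_space
begin

text \<open>
  The function \<open>exp (- c\<^sup>2 |z|\<^sup>2 / 2)\<close> is itself the characteristic function of a normal vector \<open>N\<close>.
  Writing it in this way and exchanging the two expectations leaves the characteristic functions of the
  combinations \<open>u X + v Y\<close>, which are known.
\<close>

lemma expectation_exp_norm_eq_dual_average:
  assumes XY: "\<And>u v. centered_gaussian M (\<lambda>w. u * X w + v * Y w)"
  shows "expectation (\<lambda>w. exp (- (c\<^sup>2 * ((X w)\<^sup>2 + (Y w)\<^sup>2) / 2)))
    = (LINT p|std_normal_plane. exp (- (c\<^sup>2 * expectation (\<lambda>w. (fst p * X w + snd p * Y w)\<^sup>2) / 2)))"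
proof -
  interpret NN: prob_space std_normal_plane by (rule prob_space_std_normal_plane)
  interpret MN: pair_prob_space M std_normal_plane ..
  have [measurable]: "X \<in> borel_measurable M" using XY[of 1 0] by (simp add: centered_gaussian_def)
  have [measurable]: "Y \<in> borel_measurable M" using XY[of 0 1] by (simp add: centered_gaussian_def)
  have i: "integrable (M \<Otimes>\<^sub>M std_normal_plane) (\<lambda>(w, p). iexp (fst p * (c * X w) + snd p * (c * Y w)))"
    using MN.integrable_iexp[of "\<lambda>(w, p). fst p * (c * X w) + snd p * (c * Y w)"]
    by (simp add: case_prod_beta')
  have "complex_of_real (expectation (\<lambda>w. exp (- (c\<^sup>2 * ((X w)\<^sup>2 + (Y w)\<^sup>2) / 2))))
      = (CLINT w|M. CLINT p|std_normal_plane. iexp (fst p * (c * X w) + snd p * (c * Y w)))"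
    unfolding char_std_normal_plane by (simp add: power_mult_distrib distrib_left)
  also have "\<dots> = (CLINT p|std_normal_plane. CLINT w|M. iexp (fst p * (c * X w) + snd p * (c * Y w)))"
    using MN.Fubini_integral[OF i] by simp
  also have "\<dots> = (CLINT p|std_normal_plane. CLINT w|M. iexp (c * (fst p * X w + snd p * Y w)))"
    by (simp only: distrib_left mult.left_commute)
  also have "\<dots> = (CLINT p|std_normal_plane.
      of_real (exp (- (c\<^sup>2 * expectation (\<lambda>w. (fst p * X w + snd p * Y w)\<^sup>2) / 2))))"
    using XY by (simp add: centered_gaussian_def)
  also have "\<dots> = complex_of_real (LINT p|std_normal_plane.
      exp (- (c\<^sup>2 * expectation (\<lambda>w. (fst p * X w + snd p * Y w)\<^sup>2) / 2)))"
    by (rule integral_complex_of_real)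
  finally show ?thesis by (simp only: of_real_eq_iff)
qed

text \<open>
  Write \<open>Z = (X, Y)\<close> and \<open>y = |Z|\<^sup>2 / (x S)\<close>. For \<open>y \<ge> 0\<close> the function
  \<open>exp (- 4 y) - exp (- 3) exp (- y)\<close> is at most 1, and it is negative for \<open>y > 1\<close>, so its expectation bounds the probability of the disc \<open>y \<le> 1\<close> from below. In the dual
  picture \<open>E exp (- 4 y)\<close> arises from \<open>E exp (- y)\<close> by replacing the normal vector \<open>N\<close> with \<open>2 N\<close>, and
  comparing the densities of the two vectors gives \<open>E exp (- 4 y) \<ge> E exp (- y) / 4\<close>. Finally
  \<open>V(u) \<le> |u|\<^sup>2 S\<close> bounds \<open>E exp (- y)\<close> from below by an explicit Gaussian integral.
\<close>

lemma centered_gaussian_pair_small_ball: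
  assumes XY: "\<And>u v. centered_gaussian M (\<lambda>w. u * X w + v * Y w)"
    and S: "S = expectation (\<lambda>w. (X w)\<^sup>2) + expectation (\<lambda>w. (Y w)\<^sup>2)" "S > 0"
    and x: "x > 0"
  shows "(1 / 4 - exp (- 3)) * (x / (x + 2)) \<le> prob {w \<in> space M. (X w)\<^sup>2 + (Y w)\<^sup>2 \<le> x * S}"
proof -
  interpret NN: prob_space std_normal_plane by (rule prob_space_std_normal_plane)
  have X [measurable]: "X \<in> borel_measurable M" and X2: "integrable M (\<lambda>w. (X w)\<^sup>2)"
    using XY[of 1 0] by (simp_all add: centered_gaussian_def)
  have Y [measurable]: "Y \<in> borel_measurable M" and Y2: "integrable M (\<lambda>w. (Y w)\<^sup>2)"
    using XY[of 0 1] by (simp_all add: centered_gaussian_def)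
  have XY2: "integrable M (\<lambda>w. (u * X w + v * Y w)\<^sup>2)" for u v
    using XY[of u v] by (simp add: centered_gaussian_def)
  define V where "V = (\<lambda>p. expectation (\<lambda>w. (fst p * X w + snd p * Y w)\<^sup>2))"
  have V [measurable]: "V \<in> borel_measurable (borel \<Otimes>\<^sub>M borel)"
    unfolding V_def by measurable
  have V0: "0 \<le> V p" for p unfolding V_def by simp
  have V_scale: "V (2 * fst p, 2 * snd p) = 4 * V p" for p
  proof -
    have "V (2 * fst p, 2 * snd p) = expectation (\<lambda>w. 4 * (fst p * X w + snd p * Y w)\<^sup>2)"
      unfolding V_def by (intro Bochner_Integration.integral_cong) (auto simp: power2_eq_square algebra_simps)
    then show ?thesis by (simp add: V_def)
  qed
  have V_le: "V p \<le> ((fst p)\<^sup>2 + (snd p)\<^sup>2) * S" for p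
  proof -
    have "V p \<le> expectation (\<lambda>w. ((fst p)\<^sup>2 + (snd p)\<^sup>2) * ((X w)\<^sup>2 + (Y w)\<^sup>2))"
      unfolding V_def
    proof (rule integral_mono)
      fix w
      have "0 \<le> (fst p * Y w - snd p * X w)\<^sup>2" by simp
      then show "(fst p * X w + snd p * Y w)\<^sup>2 \<le> ((fst p)\<^sup>2 + (snd p)\<^sup>2) * ((X w)\<^sup>2 + (Y w)\<^sup>2)"
        by (simp add: power2_eq_square algebra_simps)
    qed (use X2 Y2 XY2 in auto)
    then show ?thesis using X2 Y2 by (simp add: S)
  qed
  define y where "y = (\<lambda>w. ((X w)\<^sup>2 + (Y w)\<^sup>2) / (x * S))"
  have [measurable]: "y \<in> borel_measurable M" unfolding y_def by measurable
  have y0: "0 \<le> y w" for w using x S by (simp add: y_def)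
  have I: "expectation (\<lambda>w. exp (- (m\<^sup>2 * y w))) = (LINT p|std_normal_plane. exp (- (m\<^sup>2 * (V p / (x * S)))))" for m
  proof -
    define c where "c = m * sqrt (2 / (x * S))"
    have c: "c\<^sup>2 = m\<^sup>2 * (2 / (x * S))" using x S by (simp add: c_def power_mult_distrib)
    show ?thesis
      using expectation_exp_norm_eq_dual_average[OF XY, of c] unfolding c V_def y_def by simp
  qed
  define h where "h = (\<lambda>p. exp (- (V p / (x * S))))"
  have [measurable]: "h \<in> borel_measurable (borel \<Otimes>\<^sub>M borel)" unfolding h_def by measurable
  have h1: "h p \<le> 1" for p using V0[of p] x S by (simp add: h_def)
  have hint: "integrable std_normal_plane h"
    by (rule NN.integrable_const_bound[where B = 1]) (use h1 in \<open>auto simp: h_def\<close>)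
  have h2int: "integrable std_normal_plane (\<lambda>p. h (2 * fst p, 2 * snd p))"
    by (rule NN.integrable_const_bound[where B = 1]) (use h1 in \<open>auto simp: h_def\<close>)
  define I1 where "I1 = expectation (\<lambda>w. exp (- y w))"
  define I2 where "I2 = expectation (\<lambda>w. exp (- (4 * y w)))"
  have I1: "I1 = (LINT p|std_normal_plane. h p)"
    using I[of 1] by (simp add: I1_def h_def)
  have I2: "I2 = (LINT p|std_normal_plane. h (2 * fst p, 2 * snd p))"
    using I[of 2] by (simp add: I2_def h_def V_scale)
  have "ennreal I1 = (\<integral>\<^sup>+p. ennreal (h p) \<partial>std_normal_plane)"
    unfolding I1 using hint by (intro nn_integral_eq_integral[symmetric]) (auto simp: h_def)
  also have "\<dots> \<le> ennreal (2\<^sup>2) * (\<integral>\<^sup>+p. ennreal (h (2 * fst p, 2 * snd p)) \<partial>std_normal_plane)"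
    by (rule nn_integral_std_normal_plane_scale) auto
  also have "(\<integral>\<^sup>+p. ennreal (h (2 * fst p, 2 * snd p)) \<partial>std_normal_plane) = ennreal I2"
    unfolding I2 using h2int by (intro nn_integral_eq_integral) (auto simp: h_def)
  also have "ennreal (2\<^sup>2) * ennreal I2 = ennreal (4 * I2)"
    by (subst ennreal_mult) (auto simp: I2_def)
  finally have I12: "I1 \<le> 4 * I2" by (subst (asm) ennreal_le_iff) (auto simp: I2_def)
  have "ennreal (x / (x + 2)) = ennreal (1 / (1 - (- (2 / x))))"
    using x by (simp add: field_simps)
  also have "\<dots> = (\<integral>\<^sup>+p. ennreal (exp (- (2 / x) * ((fst p)\<^sup>2 + (snd p)\<^sup>2) / 2)) \<partial>std_normal_plane)"
    by (rule nn_integral_std_normal_plane_exp_norm[symmetric]) (use x in \<open>simp add: less_trans[of _ 0]\<close>)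
  also have "\<dots> \<le> (\<integral>\<^sup>+p. ennreal (h p) \<partial>std_normal_plane)"
  proof (intro nn_integral_mono ennreal_leI)
    fix p
    have "V p / (x * S) \<le> ((fst p)\<^sup>2 + (snd p)\<^sup>2) * S / (x * S)"
      using V_le[of p] x S by (intro divide_right_mono) auto
    also have "\<dots> = ((fst p)\<^sup>2 + (snd p)\<^sup>2) / x" using S by simp
    also have "\<dots> = - (- (2 / x) * ((fst p)\<^sup>2 + (snd p)\<^sup>2) / 2)"
      using x by (simp add: field_simps)
    finally show "exp (- (2 / x) * ((fst p)\<^sup>2 + (snd p)\<^sup>2) / 2) \<le> h p"
      unfolding h_def exp_le_cancel_iff by linarith
  qed
  also have "\<dots> = ennreal I1"
    unfolding I1 using hint by (intro nn_integral_eq_integral) (auto simp: h_def)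
  finally have I1_ge: "x / (x + 2) \<le> I1" by (subst (asm) ennreal_le_iff) (auto simp: I1_def)
  have e3: "exp (- 3) \<le> (1 / 4 :: real)"
    using exp_ge_add_one_self[of "3::real"] by (simp add: exp_minus field_simps)
  have ei: "integrable M (\<lambda>w. exp (- y w))" "integrable M (\<lambda>w. exp (- (4 * y w)))"
    by (rule integrable_const_bound[where B = 1]; use y0 in simp)+
  have "(1 / 4 - exp (- 3)) * (x / (x + 2)) \<le> (1 / 4 - exp (- 3)) * I1"
    using e3 I1_ge by (intro mult_left_mono) auto
  also have "\<dots> \<le> I2 - exp (- 3) * I1" using I12 by (simp add: algebra_simps)
  also have "\<dots> = expectation (\<lambda>w. exp (- (4 * y w)) - exp (- 3) * exp (- y w))"
    using ei by (simp add: I1_def I2_def)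
  also have "\<dots> \<le> expectation (indicator {w \<in> space M. y w \<le> 1})"
  proof (rule integral_mono)
    fix w assume w: "w \<in> space M"
    show "exp (- (4 * y w)) - exp (- 3) * exp (- y w) \<le> indicator {w \<in> space M. y w \<le> 1} w"
    proof (cases "y w \<le> 1")
      case True
      have "exp (- (4 * y w)) \<le> 1" "0 \<le> exp (- 3) * exp (- y w)" using y0[of w] by auto
      then have "exp (- (4 * y w)) - exp (- 3) * exp (- y w) \<le> 1" by linarith
      with True w show ?thesis by simp
    next
      case False
      then have "exp (- (4 * y w)) \<le> exp (- 3 + - y w)" by (subst exp_le_cancel_iff) simp
      with False show ?thesis by (simp add: exp_add[symmetric])
    qed
  next
    show "integrable M (indicat_real {w \<in> space M. y w \<le> 1})"
      by (intro integrable_real_indicator) (auto simp: emeasure_eq_measure)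
  qed (use ei in auto)
  also have "\<dots> = prob {w \<in> space M. (X w)\<^sup>2 + (Y w)\<^sup>2 \<le> x * S}"
    using x S by (simp add: y_def divide_le_eq)
  finally show ?thesis .
qed

text \<open>
  Markov's inequality for \<open>exp (D\<^sup>2 / 4)\<close>, where \<open>D\<close> is \<open>X\<close> scaled to unit variance (if \<open>X\<close> is not
  degenerate). Its law is standard
  normal by uniqueness of characteristic functions, and the expectation is \<open>sqrt 2\<close>.
\<close>

lemma centered_gaussian_tail:
  assumes X: "centered_gaussian M X"
  shows "prob {w \<in> space M. x * expectation (\<lambda>w. (X w)\<^sup>2) < (X w)\<^sup>2} \<le> sqrt 2 * exp (- (x / 4))"
proof -
  have [measurable]: "X \<in> borel_measurable M" and X2: "integrable M (\<lambda>w. (X w)\<^sup>2)"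
    using X by (simp_all add: centered_gaussian_def)
  define v where "v = expectation (\<lambda>w. (X w)\<^sup>2)"
  have v0: "0 \<le> v" unfolding v_def by simp
  show ?thesis
  proof (cases "v = 0")
    case True
    then have "AE w in M. (X w)\<^sup>2 = 0"
      unfolding v_def using X2 by (subst (asm) integral_nonneg_eq_0_iff_AE) auto
    then have "AE w in M. \<not> (x * v < (X w)\<^sup>2)" using True by auto
    then have "prob {w \<in> space M. x * v < (X w)\<^sup>2} = 0" by (subst prob_Collect_eq_0) auto
    then show ?thesis by (simp add: v_def)
  next
    case False
    with v0 have v: "v > 0" by simp
    define D where "D = (\<lambda>w. X w / sqrt v)"
    have [measurable]: "D \<in> borel_measurable M" unfolding D_def by measurable
    have "distr M borel D = std_normal_distribution"
    proof (rule Levy_uniqueness[OF _ real_dist_normal_dist])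
      show "real_distribution (distr M borel D)" by (rule real_distribution_distr) simp
      show "char (distr M borel D) = char std_normal_distribution"
      proof
        fix t
        have "char (distr M borel D) t = (CLINT w|M. iexp ((t / sqrt v) * X w))"
          unfolding char_def by (subst integral_distr) (auto simp: D_def)
        also have "\<dots> = of_real (exp (- ((t / sqrt v)\<^sup>2 * v / 2)))"
          using X unfolding centered_gaussian_def v_def by blast
        also have "\<dots> = char std_normal_distribution t"
          using v by (simp add: char_std_normal_distribution power_divide)
        finally show "char (distr M borel D) t = char std_normal_distribution t" .
      qed
    qed
    then have "(\<integral>\<^sup>+w. ennreal (exp ((1 / 2) * (D w)\<^sup>2 / 2)) \<partial>M) = ennreal (1 / sqrt (1 - 1 / 2))"
      using nn_integral_std_normal_exp_square[of "1 / 2"]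
        nn_integral_distr[of D M borel "\<lambda>z. ennreal (exp ((1 / 2) * z\<^sup>2 / 2))"] by simp
    also have "1 / sqrt (1 - 1 / 2) = sqrt 2" by (simp add: real_sqrt_divide)
    finally have mgf: "(\<integral>\<^sup>+w. ennreal (exp ((1 / 2) * (D w)\<^sup>2 / 2)) \<partial>M) = ennreal (sqrt 2)" .
    have "emeasure M {w \<in> space M. x * v < (X w)\<^sup>2}
        \<le> emeasure M {w \<in> space M. 1 \<le> ennreal (exp (- (x / 4))) * ennreal (exp ((1 / 2) * (D w)\<^sup>2 / 2))}"
    proof (rule emeasure_mono)
      show "{w \<in> space M. x * v < (X w)\<^sup>2}
          \<subseteq> {w \<in> space M. 1 \<le> ennreal (exp (- (x / 4))) * ennreal (exp ((1 / 2) * (D w)\<^sup>2 / 2))}"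
      proof safe
        fix w assume "x * v < (X w)\<^sup>2"
        then have "x < (D w)\<^sup>2" using v by (simp add: D_def power_divide less_divide_eq)
        then have "1 \<le> exp (- (x / 4)) * exp ((1 / 2) * (D w)\<^sup>2 / 2)" by (simp add: exp_add[symmetric])
        then show "1 \<le> ennreal (exp (- (x / 4))) * ennreal (exp ((1 / 2) * (D w)\<^sup>2 / 2))"
          by (simp add: ennreal_mult[symmetric])
      qed
    qed measurable
    also have "\<dots> \<le> ennreal (exp (- (x / 4))) * (\<integral>\<^sup>+w. ennreal (exp ((1 / 2) * (D w)\<^sup>2 / 2)) * indicator (space M) w \<partial>M)"
      by (rule nn_integral_Markov_inequality) auto
    also have "(\<integral>\<^sup>+w. ennreal (exp ((1 / 2) * (D w)\<^sup>2 / 2)) * indicator (space M) w \<partial>M) = ennreal (sqrt 2)"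
      unfolding mgf[symmetric] by (intro nn_integral_cong) auto
    also have "ennreal (exp (- (x / 4))) * ennreal (sqrt 2) = ennreal (sqrt 2 * exp (- (x / 4)))"
      by (simp add: ennreal_mult mult.commute)
    finally show ?thesis
      by (simp add: emeasure_eq_measure v_def)
  qed
qed

text \<open>
  Each range of \<open>x\<close> has its own reason. As \<open>x\<close> tends to 0 the right-hand side tends to 1 and only the
  small-disc bound helps; from \<open>x = 28/25\<close> to \<open>x = 8\<close> Markov's bound \<open>1 / x\<close> is good enough; and from \<open>x = 8\<close> on so
  is the sum of the tails of the coordinates, since \<open>X\<^sup>2 + Y\<^sup>2 > x S\<close> makes one of the coordinates exceed its
  share of \<open>x S\<close>.
\<close>

lemma centered_gaussian_pair_tail:
  assumes XY: "\<And>u v. centered_gaussian M (\<lambda>w. u * X w + v * Y w)"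
    and S: "S = expectation (\<lambda>w. (X w)\<^sup>2) + expectation (\<lambda>w. (Y w)\<^sup>2)" "S > 0"
    and x: "x > 0"
  shows "prob {w \<in> space M. x * S < (X w)\<^sup>2 + (Y w)\<^sup>2} \<le> exp (- (x / 16))"
proof -
  have X: "centered_gaussian M X" using XY[of 1 0] by simp
  have Y: "centered_gaussian M Y" using XY[of 0 1] by simp
  have [measurable]: "X \<in> borel_measurable M" and X2: "integrable M (\<lambda>w. (X w)\<^sup>2)"
    using X by (simp_all add: centered_gaussian_def)
  have [measurable]: "Y \<in> borel_measurable M" and Y2: "integrable M (\<lambda>w. (Y w)\<^sup>2)"
    using Y by (simp_all add: centered_gaussian_def)
  let ?A = "{w \<in> space M. x * S < (X w)\<^sup>2 + (Y w)\<^sup>2}"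
  consider "x \<le> 28 / 25" | "28 / 25 \<le> x" "x \<le> 8" | "8 \<le> x" by linarith
  then show ?thesis
  proof cases
    case 1
    \<comment> \<open>For \<open>x \<le> 28/25\<close> the small-disc bound suffices once \<open>exp (- 3) \<le> 11/200\<close>; \<open>13/8\<close> is the quadratic Taylor
      bound for \<open>exp (1/2)\<close>.\<close>
    have "(13 / 8 :: real) ^ 6 \<le> exp (1 / 2) ^ 6"
      using exp_lower_Taylor_quadratic[of "1 / 2"] by (intro power_mono) (auto simp: power2_eq_square)
    also have "exp (1 / 2 :: real) ^ 6 = exp 3"
      by (simp add: exp_of_nat_mult[symmetric])
    finally have "200 / 11 \<le> exp (3 :: real)" by (simp add: power_divide)
    then have e3: "exp (- 3) \<le> (11 / 200 :: real)"
      by (simp add: exp_minus field_simps)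
    have "(1 / 16) * x \<le> (39 / 200) * (x / (x + 2))"
      using 1 x by (simp add: field_simps)
    also have "\<dots> \<le> (1 / 4 - exp (- 3)) * (x / (x + 2))"
      using e3 x by (intro mult_right_mono) auto
    finally have "(1 / 16) * x \<le> (1 / 4 - exp (- 3)) * (x / (x + 2))" .
    also have "\<dots> \<le> prob {w \<in> space M. (X w)\<^sup>2 + (Y w)\<^sup>2 \<le> x * S}"
      by (rule centered_gaussian_pair_small_ball[OF XY S x])
    also have "{w \<in> space M. (X w)\<^sup>2 + (Y w)\<^sup>2 \<le> x * S} = space M - ?A" by auto
    also have "prob (space M - ?A) = 1 - prob ?A" by (rule prob_compl) measurable
    finally have "prob ?A \<le> 1 + - (x / 16)" by simp
    also have "\<dots> \<le> exp (- (x / 16))" by (rule exp_ge_add_one_self)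
    finally show ?thesis .
  next
    case 2
    have "prob ?A \<le> prob {w \<in> space M. x * S \<le> (X w)\<^sup>2 + (Y w)\<^sup>2}"
      by (intro finite_measure_mono) auto
    also have "\<dots> \<le> expectation (\<lambda>w. (X w)\<^sup>2 + (Y w)\<^sup>2) / (x * S)"
      using X2 Y2 x S by (intro integral_Markov_inequality_measure[where A = "{}"]) auto
    also have "\<dots> = 1 / x" using X2 Y2 S x by (simp flip: S(1))
    also have "\<dots> \<le> exp (- (x / 16))"
    proof -
      have "exp (x / 16) \<le> 1 + x / 16 + (x / 16)\<^sup>2"
        using 2 by (intro exp_bound) auto
      also have "(x / 16)\<^sup>2 \<le> 8 * x / 256"
        using 2 mult_right_mono[of x 8 x] by (simp add: power2_eq_square)
      also have "1 + x / 16 + 8 * x / 256 \<le> x" using 2 by simp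
      finally show ?thesis using x by (simp add: exp_minus field_simps)
    qed
    finally show ?thesis .
  next
    case 3
    let ?B = "\<lambda>Z. {w \<in> space M. x * expectation (\<lambda>w. (Z w)\<^sup>2) < (Z w)\<^sup>2}"
    have "prob ?A \<le> prob (?B X \<union> ?B Y)"
      by (intro finite_measure_mono) (auto simp: S(1) distrib_left)
    also have "\<dots> \<le> prob (?B X) + prob (?B Y)"
      by (intro measure_Un_le) measurable
    also have "\<dots> \<le> 2 * sqrt 2 * exp (- (x / 4))"
      using centered_gaussian_tail[OF X, of x] centered_gaussian_tail[OF Y, of x] by simp
    also have "\<dots> \<le> exp (3 * x / 16) * exp (- (x / 4))"
    proof (rule mult_right_mono)
      have "sqrt 2 \<le> 3 / 2" by (rule real_le_lsqrt) (auto simp: power2_eq_square)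
      moreover have "3 \<le> exp (3 / 2 :: real)"
        using exp_lower_Taylor_quadratic[of "3 / 2"] by (simp add: power2_eq_square)
      moreover have "exp (3 / 2) \<le> exp (3 * x / 16)" using 3 by simp
      ultimately show "2 * sqrt 2 \<le> exp (3 * x / 16)" by linarith
    qed simp
    also have "\<dots> = exp (- (x / 16))" by (simp add: exp_add[symmetric])
    finally show ?thesis .
  qed
qed

end

section \<open>The wavelet transform of the noise\<close>

lemma sigma_finite_lebesgue: "sigma_finite_measure (lebesgue :: 'a::euclidean_space measure)"
proof
  obtain A :: "'a set set" where A: "countable A" "A \<subseteq> sets lborel" "\<Union>A = space lborel"
      "\<forall>a\<in>A. emeasure lborel a \<noteq> \<infinity>"
    using lborel.sigma_finite_countable by metis
  then show "\<exists>A::'a set set. countable A \<and> A \<subseteq> sets lebesgue \<and> \<Union>A = space lebesgue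
      \<and> (\<forall>a\<in>A. emeasure lebesgue a \<noteq> \<infinity>)"
    by (intro exI[of _ A]) (auto simp: subset_iff)
qed

definition wavelet_kernel :: "(real \<Rightarrow> complex) \<Rightarrow> real \<Rightarrow> real \<Rightarrow> real \<Rightarrow> complex" where
  "wavelet_kernel \<psi> t s \<tau> = of_real (1 / sqrt s) * cnj (\<psi> ((\<tau> - t) / s))"

lemma wavelet_transform_eq_kernel:
  "wavelet_transform \<psi> g t s = (CLINT \<tau>|lebesgue. of_real (g \<tau>) * wavelet_kernel \<psi> t s \<tau>)"
  by (simp add: wavelet_transform_def wavelet_kernel_def mult.assoc)

text \<open>
  The integral is, up to a factor, the conjugate of the Fourier transform of \<open>\<psi>\<close> at frequency zero, and
  this vanishes because the wavelet is analytic.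
\<close>

lemma wavelet_kernel_integral:
  assumes \<psi>: "analytic_mother_wavelet \<psi>" and s: "s > 0"
  shows "integrable lebesgue (wavelet_kernel \<psi> t s)"
    and "(CLINT \<tau>|lebesgue. wavelet_kernel \<psi> t s \<tau>) = 0"
proof -
  have i: "integrable lebesgue \<psi>" and z: "fourier_transform \<psi> 0 = 0"
    using \<psi> by (auto simp: analytic_mother_wavelet_def)
  have eq: "\<psi> ((\<tau> - t) / s) = \<psi> (- t / s + (1 / s) * \<tau>)" for \<tau>
    by (simp add: diff_divide_distrib)
  have "integrable lebesgue (\<lambda>\<tau>. \<psi> ((\<tau> - t) / s))"
    unfolding eq using i s by (intro lebesgue_integrable_real_affine) auto
  then show "integrable lebesgue (wavelet_kernel \<psi> t s)"
    unfolding wavelet_kernel_def[abs_def] by simp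
  have "(CLINT \<tau>|lebesgue. \<psi> \<tau>) = 0"
    using z by (simp add: fourier_transform_def)
  then have "(CLINT \<tau>|lebesgue. \<psi> ((\<tau> - t) / s)) = 0"
    unfolding eq using lebesgue_integral_real_affine[of "1 / s" \<psi> "- t / s"] s by simp
  then show "(CLINT \<tau>|lebesgue. wavelet_kernel \<psi> t s \<tau>) = 0"
    unfolding wavelet_kernel_def by simp
qed

context prob_space
begin

text \<open>
  Bounded second moments bound the first absolute moments, so Fubini's theorem applies. Almost every
  path may therefore be integrated against the kernel, and the integrals may be added and split into
  real and imaginary parts.
\<close>

lemma AE_integrable_weighted_process:
  fixes \<Phi> :: "'t \<Rightarrow> 'a \<Rightarrow> real" and k :: "'t \<Rightarrow> complex"
  assumes N: "sigma_finite_measure N"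
    and \<Phi> [measurable]: "(\<lambda>(\<tau>, w). \<Phi> \<tau> w) \<in> borel_measurable (N \<Otimes>\<^sub>M M)"
    and \<Phi>2: "\<And>\<tau>. integrable M (\<lambda>w. (\<Phi> \<tau> w)\<^sup>2)"
    and K: "\<And>\<tau>. expectation (\<lambda>w. (\<Phi> \<tau> w)\<^sup>2) \<le> K"
    and k: "integrable N k"
  shows "AE w in M. integrable N (\<lambda>\<tau>. of_real (\<Phi> \<tau> w) * k \<tau>)"
proof -
  interpret N: sigma_finite_measure N by (rule N)
  interpret NM: pair_sigma_finite N M ..
  interpret MN: pair_sigma_finite M N ..
  have [measurable]: "k \<in> borel_measurable N" using k by simp
  have \<Phi>m: "\<Phi> \<tau> \<in> borel_measurable M" if "\<tau> \<in> space N" for \<tau> using that by measurable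
  have \<Phi>1: "integrable M (\<Phi> \<tau>)" if "\<tau> \<in> space N" for \<tau>
    by (rule integrable_of_square_integrable[OF \<Phi>m[OF that] \<Phi>2])
  have bound: "expectation (\<lambda>w. \<bar>\<Phi> \<tau> w\<bar>) \<le> K + 1" if "\<tau> \<in> space N" for \<tau>
  proof -
    have "\<bar>r\<bar> \<le> r\<^sup>2 + 1" for r :: real
      using zero_le_power2[of "\<bar>r\<bar> - 1"] by (simp add: power2_diff)
    then have "expectation (\<lambda>w. \<bar>\<Phi> \<tau> w\<bar>) \<le> expectation (\<lambda>w. (\<Phi> \<tau> w)\<^sup>2 + 1)"
      using \<Phi>1[OF that] \<Phi>2 by (intro integral_mono) auto
    also have "\<dots> \<le> K + 1" using \<Phi>2 K[of \<tau>] by (simp add: prob_space)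
    finally show ?thesis .
  qed
  have "integrable (N \<Otimes>\<^sub>M M) (\<lambda>(\<tau>, w). of_real (\<Phi> \<tau> w) * k \<tau>)"
  proof (rule NM.Fubini_integrable)
    show "(\<lambda>(\<tau>, w). of_real (\<Phi> \<tau> w) * k \<tau>) \<in> borel_measurable (N \<Otimes>\<^sub>M M)" by measurable
    show "AE \<tau> in N. integrable M (\<lambda>w. case (\<tau>, w) of (\<tau>, w) \<Rightarrow> of_real (\<Phi> \<tau> w) * k \<tau>)"
      using \<Phi>1 by (auto intro!: AE_I2)
    have "integrable N (\<lambda>\<tau>. expectation (\<lambda>w. \<bar>\<Phi> \<tau> w\<bar>) * norm (k \<tau>))"
    proof (rule Bochner_Integration.integrable_bound)
      show "integrable N (\<lambda>\<tau>. (K + 1) * norm (k \<tau>))" using k by simp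
      show "AE \<tau> in N. norm (expectation (\<lambda>w. \<bar>\<Phi> \<tau> w\<bar>) * norm (k \<tau>)) \<le> norm ((K + 1) * norm (k \<tau>))"
      proof (rule AE_I2)
        fix \<tau> assume \<tau>: "\<tau> \<in> space N"
        have "0 \<le> expectation (\<lambda>w. \<bar>\<Phi> \<tau> w\<bar>)" by simp
        with bound[OF \<tau>] have "\<bar>expectation (\<lambda>w. \<bar>\<Phi> \<tau> w\<bar>)\<bar> \<le> \<bar>K + 1\<bar>" by linarith
        then show "norm (expectation (\<lambda>w. \<bar>\<Phi> \<tau> w\<bar>) * norm (k \<tau>)) \<le> norm ((K + 1) * norm (k \<tau>))"
          unfolding real_norm_def abs_mult by (intro mult_right_mono) auto
      qed
    qed measurable
    then show "integrable N (\<lambda>\<tau>. LINT w|M. norm (case (\<tau>, w) of (\<tau>, w) \<Rightarrow> of_real (\<Phi> \<tau> w) * k \<tau>))"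
      by (simp add: norm_mult)
  qed
  from MN.AE_integrable_fst'[OF NM.integrable_product_swap[OF this]]
  show ?thesis by simp
qed

lemma gaussian_process_centered:
  assumes gauss: "gaussian_process M \<Phi>" and mean: "\<And>\<tau>. expectation (\<Phi> \<tau>) = \<mu>" and T: "finite T"
  shows "centered_gaussian M (\<lambda>w. \<Sum>t\<in>T. a t * (\<Phi> t w - \<mu>))"
proof -
  have "integrable M (\<Phi> \<tau>)" for \<tau>
  proof -
    have g: "gaussian_variable M (\<Phi> \<tau>)"
      using gauss[unfolded gaussian_process_def, rule_format, of "{\<tau>}" "\<lambda>_. 1"] by simp
    then have "\<Phi> \<tau> \<in> borel_measurable M" by (simp add: gaussian_variable_def)
    then show ?thesis
      by (rule integrable_of_square_integrable[OF _ gaussian_variable_centered(1)[OF g]])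
  qed
  then have "expectation (\<lambda>w. \<Sum>t\<in>T. a t * \<Phi> t w) = (\<Sum>t\<in>T. a t * \<mu>)"
    using mean by (simp add: Bochner_Integration.integral_sum)
  moreover have "gaussian_variable M (\<lambda>w. \<Sum>t\<in>T. a t * \<Phi> t w)"
    using gauss T by (auto simp: gaussian_process_def)
  ultimately show ?thesis
    using gaussian_variable_centered(2)[of "\<lambda>w. \<Sum>t\<in>T. a t * \<Phi> t w"]
    by (simp add: right_diff_distrib sum_subtractf)
qed

end

theorem proposition2:
  fixes M :: "'w measure"
    and \<psi> :: "real \<Rightarrow> complex"
    and f :: "real \<Rightarrow> real"
    and \<Phi> Y :: "real \<Rightarrow> 'w \<Rightarrow> real"
    and C :: "real \<Rightarrow> real"
    and F :: "real measure"
    and t s \<epsilon> :: real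
  assumes "prob_space M"
    and "analytic_mother_wavelet \<psi>"
    and "bounded (range f)"
    and "gaussian_process M \<Phi>"
    and "jointly_measurable M \<Phi>"
    and "stationary_with_covariance M \<Phi> C"
    and "spectral_measure_of F C"
    and Y: "\<And>\<tau> w. Y \<tau> w = f \<tau> + \<Phi> \<tau> w"
    and "s > 0"
    and "wavelet_transform \<psi> f t s \<noteq> 0"
    and "(LINT w|M. (cmod (wavelet_transform \<psi> (\<lambda>\<tau>. \<Phi> \<tau> w) t s))\<^sup>2) > 0"
    and "\<epsilon> > 0"
  shows "measure M {w \<in> space M.
           \<bar>cmod (wavelet_transform \<psi> (\<lambda>\<tau>. Y \<tau> w) t s) / cmod (wavelet_transform \<psi> f t s) - 1\<bar> > \<epsilon>}
         \<le> exp (- (\<epsilon>\<^sup>2 / 16) * signal_noise_ratio M \<psi> f \<Phi> t s)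
           + exp (- (\<epsilon> / 2) * signal_noise_ratio M \<psi> f \<Phi> t s)"
proof -
  interpret prob_space M by fact
  interpret leb: sigma_finite_measure "lebesgue :: real measure" by (rule sigma_finite_lebesgue)
  have \<Phi> [measurable]: "(\<lambda>(\<tau>, w). \<Phi> \<tau> w) \<in> borel_measurable (lebesgue \<Otimes>\<^sub>M M)"
    using assms(5) by (simp add: jointly_measurable_def)
  obtain \<mu> where mean: "\<And>\<tau>. expectation (\<Phi> \<tau>) = \<mu>"
    using assms(6) by (auto simp: stationary_with_covariance_def)
  define k where "k = wavelet_kernel \<psi> t s"
  have k: "integrable lebesgue k" and k0: "(CLINT \<tau>|lebesgue. k \<tau>) = 0"
    unfolding k_def using wavelet_kernel_integral[OF assms(2) \<open>s > 0\<close>] by auto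
  have [measurable]: "k \<in> borel_measurable lebesgue" using k by simp
  \<comment> \<open>The kernel integrates to zero, so centring the noise does not change its transform.\<close>
  define \<Psi> where "\<Psi> = (\<lambda>\<tau> w. \<Phi> \<tau> w - \<mu>)"
  have \<Psi> [measurable]: "(\<lambda>(\<tau>, w). \<Psi> \<tau> w) \<in> borel_measurable (lebesgue \<Otimes>\<^sub>M M)"
    unfolding \<Psi>_def by measurable
  have gauss: "centered_gaussian M (\<lambda>w. \<Sum>t\<in>T. a t * \<Psi> t w)" if "finite T" for T a
    unfolding \<Psi>_def using assms(4) mean that by (rule gaussian_process_centered)
  have \<Psi>2: "integrable M (\<lambda>w. (\<Psi> \<tau> w)\<^sup>2)" for \<tau>
    using gauss[of "{\<tau>}" "\<lambda>_. 1"] by (simp add: centered_gaussian_def)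
  have var: "expectation (\<lambda>w. (\<Psi> \<tau> w)\<^sup>2) \<le> C 0" for \<tau>
  proof -
    have "covariance M (\<Phi> \<tau>) (\<Phi> \<tau>) = C (\<tau> - \<tau>)"
      using assms(6) by (auto simp: stationary_with_covariance_def)
    then show ?thesis by (simp add: covariance_def mean \<Psi>_def power2_eq_square)
  qed
  let ?W = "\<lambda>g. wavelet_transform \<psi> g t s"
  define X where "X = (\<lambda>w. LINT \<tau>|lebesgue. Re (k \<tau>) * \<Psi> \<tau> w)"
  define Z where "Z = (\<lambda>w. LINT \<tau>|lebesgue. Im (k \<tau>) * \<Psi> \<tau> w)"
  have int: "AE w in M. integrable lebesgue (\<lambda>\<tau>. of_real (\<Psi> \<tau> w) * k \<tau>)"
    by (rule AE_integrable_weighted_process[OF sigma_finite_lebesgue \<Psi> \<Psi>2 var k])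
  have parts: "integrable lebesgue (\<lambda>\<tau>. Re (k \<tau>) * \<Psi> \<tau> w)" "integrable lebesgue (\<lambda>\<tau>. Im (k \<tau>) * \<Psi> \<tau> w)"
    "(CLINT \<tau>|lebesgue. of_real (\<Psi> \<tau> w) * k \<tau>) = Complex (X w) (Z w)"
    if "integrable lebesgue (\<lambda>\<tau>. of_real (\<Psi> \<tau> w) * k \<tau>)" for w
    using integrable_Re[OF that] integrable_Im[OF that] integral_Re[OF that] integral_Im[OF that]
    by (simp_all add: X_def Z_def mult.commute complex_eq_iff)
  have gaussXZ: "centered_gaussian M (\<lambda>w. u * X w + v * Z w)" for u v
  proof (rule centered_gaussian_cong_AE)
    have g: "centered_gaussian M (\<lambda>w. LINT \<tau>|lebesgue. h \<tau> * \<Psi> \<tau> w)" if "integrable lebesgue h" for h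
      by (rule centered_gaussian_integral[OF sigma_finite_lebesgue \<Psi> gauss var that])
    show "centered_gaussian M (\<lambda>w. LINT \<tau>|lebesgue. (u * Re (k \<tau>) + v * Im (k \<tau>)) * \<Psi> \<tau> w)"
      using k by (intro g) auto
    have "X \<in> borel_measurable M" "Z \<in> borel_measurable M"
      unfolding X_def Z_def using g k by (auto simp: centered_gaussian_def)
    then show "(\<lambda>w. u * X w + v * Z w) \<in> borel_measurable M" by measurable
    show "AE w in M. (LINT \<tau>|lebesgue. (u * Re (k \<tau>) + v * Im (k \<tau>)) * \<Psi> \<tau> w) = u * X w + v * Z w"
      using int
    proof eventually_elim
      case (elim w)
      have "(LINT \<tau>|lebesgue. (u * Re (k \<tau>) + v * Im (k \<tau>)) * \<Psi> \<tau> w)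
          = (LINT \<tau>|lebesgue. u * (Re (k \<tau>) * \<Psi> \<tau> w) + v * (Im (k \<tau>) * \<Psi> \<tau> w))"
        by (simp add: algebra_simps)
      also have "\<dots> = u * X w + v * Z w"
        using parts[OF elim] by (simp add: X_def Z_def)
      finally show ?case .
    qed
  qed
  have X: "X \<in> borel_measurable M" "integrable M (\<lambda>w. (X w)\<^sup>2)"
    using gaussXZ[of 1 0] by (simp_all add: centered_gaussian_def)
  have Z: "Z \<in> borel_measurable M" "integrable M (\<lambda>w. (Z w)\<^sup>2)"
    using gaussXZ[of 0 1] by (simp_all add: centered_gaussian_def)
  note [measurable] = X(1) Z(1)
  have \<Phi>W: "integrable lebesgue (\<lambda>\<tau>. of_real (\<Phi> \<tau> w) * k \<tau>) \<and> ?W (\<lambda>\<tau>. \<Phi> \<tau> w) = Complex (X w) (Z w)"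
    if "integrable lebesgue (\<lambda>\<tau>. of_real (\<Psi> \<tau> w) * k \<tau>)" for w
  proof -
    have eq: "of_real (\<Phi> \<tau> w) * k \<tau> = of_real (\<Psi> \<tau> w) * k \<tau> + of_real \<mu> * k \<tau>" for \<tau>
      by (simp add: \<Psi>_def algebra_simps)
    show ?thesis
      using that k k0 parts(3)[OF that] by (simp add: wavelet_transform_eq_kernel k_def[symmetric] eq)
  qed
  \<comment> \<open>A function that is not integrable has integral zero, so \<open>W_f \<noteq> 0\<close> entails integrability.\<close>
  have fk: "integrable lebesgue (\<lambda>\<tau>. of_real (f \<tau>) * k \<tau>)"
    using assms(10) not_integrable_integral_eq by (auto simp: wavelet_transform_eq_kernel k_def)
  have WY: "AE w in M. ?W (\<lambda>\<tau>. Y \<tau> w) = ?W f + Complex (X w) (Z w)"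
    using int
  proof eventually_elim
    case (elim w)
    have "?W (\<lambda>\<tau>. Y \<tau> w) = ?W f + ?W (\<lambda>\<tau>. \<Phi> \<tau> w)"
      using fk \<Phi>W[OF elim] by (simp add: wavelet_transform_eq_kernel k_def[symmetric] Y distrib_right)
    then show ?case using \<Phi>W[OF elim] by simp
  qed
  define S where "S = (LINT w|M. (cmod (?W (\<lambda>\<tau>. \<Phi> \<tau> w)))\<^sup>2)"
  have S: "S = expectation (\<lambda>w. (X w)\<^sup>2) + expectation (\<lambda>w. (Z w)\<^sup>2)"
  proof -
    have "(\<lambda>(w, \<tau>). \<Phi> \<tau> w) \<in> borel_measurable (M \<Otimes>\<^sub>M lebesgue)"
      using measurable_compose[OF measurable_pair_swap' \<Phi>] by (simp add: case_prod_beta')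
    then have [measurable]: "(\<lambda>w. ?W (\<lambda>\<tau>. \<Phi> \<tau> w)) \<in> borel_measurable M"
      unfolding wavelet_transform_eq_kernel k_def[symmetric] by measurable
    have "S = expectation (\<lambda>w. (X w)\<^sup>2 + (Z w)\<^sup>2)"
      unfolding S_def
    proof (rule integral_cong_AE)
      show "AE w in M. (cmod (?W (\<lambda>\<tau>. \<Phi> \<tau> w)))\<^sup>2 = (X w)\<^sup>2 + (Z w)\<^sup>2"
        using int by eventually_elim (simp add: \<Phi>W cmod_power2)
    qed measurable
    then show ?thesis using X Z by simp
  qed
  have S0: "S > 0" using assms(11) by (simp add: S_def)
  define r where "r = cmod (?W f)"
  have r: "r > 0" using assms(10) by (simp add: r_def)
  define q where "q = signal_noise_ratio M \<psi> f \<Phi> t s"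
  have q: "q = r\<^sup>2 / S" by (simp add: q_def signal_noise_ratio_def S_def r_def)
  have "measure M {w \<in> space M. \<bar>cmod (?W (\<lambda>\<tau>. Y \<tau> w)) / r - 1\<bar> > \<epsilon>}
      \<le> measure M {w \<in> space M. (\<epsilon>\<^sup>2 * q) * S < (X w)\<^sup>2 + (Z w)\<^sup>2}"
  proof (rule finite_measure_mono_AE)
    show "AE w in M. w \<in> {w \<in> space M. \<bar>cmod (?W (\<lambda>\<tau>. Y \<tau> w)) / r - 1\<bar> > \<epsilon>}
        \<longrightarrow> w \<in> {w \<in> space M. (\<epsilon>\<^sup>2 * q) * S < (X w)\<^sup>2 + (Z w)\<^sup>2}"
      using WY
    proof eventually_elim
      case (elim w)
      have "(\<epsilon>\<^sup>2 * q) * S < (X w)\<^sup>2 + (Z w)\<^sup>2" if dev: "\<bar>cmod (?W (\<lambda>\<tau>. Y \<tau> w)) / r - 1\<bar> > \<epsilon>"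
      proof -
        have "\<epsilon> * r < \<bar>cmod (?W (\<lambda>\<tau>. Y \<tau> w)) / r - 1\<bar> * r" using dev r by simp
        also have "\<dots> = \<bar>(cmod (?W (\<lambda>\<tau>. Y \<tau> w)) / r - 1) * r\<bar>" using r by (simp add: abs_mult)
        also have "\<dots> = \<bar>cmod (?W f + Complex (X w) (Z w)) - cmod (?W f)\<bar>"
          using r by (simp add: elim left_diff_distrib r_def)
        also have "\<dots> \<le> cmod (Complex (X w) (Z w))"
          using norm_triangle_ineq3[of "?W f + Complex (X w) (Z w)" "?W f"] by simp
        finally have "(\<epsilon> * r)\<^sup>2 < (cmod (Complex (X w) (Z w)))\<^sup>2"
          using r \<open>\<epsilon> > 0\<close> by (intro power_strict_mono) auto
        then show ?thesis using S0 by (simp add: q cmod_power2 power_mult_distrib)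
      qed
      then show ?case by auto
    qed
  qed measurable
  also have "\<dots> \<le> exp (- ((\<epsilon>\<^sup>2 * q) / 16))"
    by (rule centered_gaussian_pair_tail[OF gaussXZ S S0]) (use r S0 \<open>\<epsilon> > 0\<close> in \<open>simp add: q\<close>)
  also have "\<dots> \<le> exp (- (\<epsilon>\<^sup>2 / 16) * q) + exp (- (\<epsilon> / 2) * q)" by simp
  finally show ?thesis by (simp only: q_def r_def)
qed

end
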